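(* Let $p>3$ be a prime. Then $$\sum_{k=1}^{p-1}\binom{2k}{k}^3\frac{H_k}{64^k}\equiv \begin{cases} \Gamma_p^4\left(\frac{1}{4}\right)\cdot\left(2q_p(2)-p\,q_p(2)^2\right) & \text{if } p\equiv 1 \pmod 4,\\[2mm] -\frac{p}{12}\,\Gamma_p^4\left(\frac{1}{4}\right) & \text{if } p\equiv 3 \pmod 4, \end{cases}\pmod{p^2}$$ and $$\sum_{k=1}^{p-1}\binom{2k}{k}^3\frac{H_k^{(2)}}{64^k}\equiv \begin{cases} -\Gamma_p^4\left(\frac{1}{4}\right)\cdot\left(4E_{p-3}-2E_{2p-4}\right) & \text{if } p\equiv 1 \pmod 4,\\[2mm] -\frac{1}{4}\,\Gamma_p^4\left(\frac{1}{4}\right) & \text{if } p\equiv 3 \pmod 4, \end{cases}\pmod{p^2}.$$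
   Context: For integers $k\ge 0$ and $r\ge1$, $H_k^{(r)}=\sum_{j=1}^{k}\frac{1}{j^r}$ and $H_k=H_k^{(1)}$. $q_p(2)=\frac{2^{p-1}-1}{p}$ is the Fermat quotient. $E_n$ denotes the $n$-th Euler number, $\frac{2}{e^t+e^{-t}}=\sum_{n\ge0}E_n\frac{t^n}{n!}$ (so $E_0=1$, $E_2=-1$, $E_4=5$, $E_6=-61$). $\Gamma_p:\mathbb{Z}_p\to\mathbb{Z}_p$ is Morita's $p$-adic Gamma function, the continuous extension to $\mathbb{Z}_p$ of $n\mapsto(-1)^n\prod_{0\le k<n,\ (k,p)=1}k$ for integers $n>1$; $\Gamma_p^4(x)$ means $(\Gamma_p(x))^4$. Congruences are between elements of $\mathbb{Z}_p$ (all quantities are $p$-adic integers): $a\equiv b\pmod{p^r}$ means $a-b\in p^r\mathbb{Z}_p$. *)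

theory Defs
  imports
    "HOL-Algebra.QuotRing"
    "HOL-Analysis.Function_Topology"
    "HOL-Computational_Algebra.Computational_Algebra"
    "HOL-Number_Theory.Number_Theory"
begin

definition gen_harm :: "nat \<Rightarrow> nat \<Rightarrow> rat" where
  "gen_harm r k = (\<Sum>j=1..k. 1 / of_nat j ^ r)"

definition fermat_quotient :: "nat \<Rightarrow> nat \<Rightarrow> rat" where
  "fermat_quotient p a = (of_nat a ^ (p - 1) - 1) / of_nat p"

definition euler_number :: "nat \<Rightarrow> rat" where
  "euler_number n = fact n * fps_nth (2 / (fps_exp 1 + fps_exp (- 1))) n"


text \<open>
  The ring of p-adic integers as the inverse limit of the rings of integers modulo p^n: an element
  is the sequence of its reductions modulo p^n, each represented in the interval from 0 to p^n - 1.
\<close>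

definition padic_int :: "nat \<Rightarrow> (nat \<Rightarrow> int) ring" where
  "padic_int p =
     \<lparr>carrier = {x. \<forall>n. x n \<in> {0..<int p ^ n} \<and> x (Suc n) mod int p ^ n = x n},
      monoid.mult = (\<lambda>x y n. (x n * y n) mod int p ^ n),
      one = (\<lambda>n. 1 mod int p ^ n),
      zero = (\<lambda>n. 0),
      add = (\<lambda>x y n. (x n + y n) mod int p ^ n)\<rparr>"

definition padic_of_int :: "nat \<Rightarrow> int \<Rightarrow> nat \<Rightarrow> int" where
  "padic_of_int p a = (\<lambda>n. a mod int p ^ n)"

text \<open>
  The embedding of the rational numbers whose reduced denominator is prime to p; it is not
  meaningful for other rational numbers.
\<close>

definition padic_of_rat :: "nat \<Rightarrow> rat \<Rightarrow> nat \<Rightarrow> int" where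
  "padic_of_rat p q =
     (case quotient_of q of (a, b) \<Rightarrow>
        padic_of_int p a \<otimes>\<^bsub>padic_int p\<^esub> inv\<^bsub>padic_int p\<^esub> (padic_of_int p b))"

definition padic_cong :: "nat \<Rightarrow> nat \<Rightarrow> (nat \<Rightarrow> int) \<Rightarrow> (nat \<Rightarrow> int) \<Rightarrow> bool" where
  "padic_cong p r x y \<longleftrightarrow>
     x \<in> carrier (padic_int p) \<and> y \<in> carrier (padic_int p) \<and>
     x \<ominus>\<^bsub>padic_int p\<^esub> y \<in> PIdl\<^bsub>padic_int p\<^esub> (padic_of_int p (int p ^ r))"

text \<open>
  Morita's p-adic Gamma function. Continuity refers to the product topology of the discrete
  topologies on the components, which on the inverse limit is the p-adic topology (see
  \<open>continuous_on_padic_iff\<close> below). Outside the p-adic integers the function is \<open>undefined\<close>,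
  which makes it unique.
\<close>

definition padic_Gamma :: "nat \<Rightarrow> (nat \<Rightarrow> int) \<Rightarrow> (nat \<Rightarrow> int)" where
  "padic_Gamma p =
     (THE g. g \<in> carrier (padic_int p) \<rightarrow>\<^sub>E carrier (padic_int p) \<and>
             continuous_on (carrier (padic_int p)) g \<and>
             (\<forall>n>1. g (padic_of_int p (int n)) =
                padic_of_int p ((- 1) ^ n * (\<Prod>k | k < n \<and> coprime k p. int k))))"


lemma padic_int_simps:
  "x \<in> carrier (padic_int p) \<longleftrightarrow>
     (\<forall>n. x n \<in> {0..<int p ^ n} \<and> x (Suc n) mod int p ^ n = x n)"
  "x \<otimes>\<^bsub>padic_int p\<^esub> y = (\<lambda>n. (x n * y n) mod int p ^ n)"
  "x \<oplus>\<^bsub>padic_int p\<^esub> y = (\<lambda>n. (x n + y n) mod int p ^ n)"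
  "\<one>\<^bsub>padic_int p\<^esub> = (\<lambda>n. 1 mod int p ^ n)"
  "\<zero>\<^bsub>padic_int p\<^esub> = (\<lambda>n. 0)"
  by (simp_all add: padic_int_def)

lemma mod_pow_Suc: "(a::int) mod int p ^ Suc n mod int p ^ n = a mod int p ^ n"
  by (rule mod_mod_cancel) simp

lemma padic_of_fun_closed:
  assumes "p > 0" "\<And>n. [f (Suc n) = f n] (mod int p ^ n)"
  shows "(\<lambda>n. f n mod int p ^ n) \<in> carrier (padic_int p)"
  using assms by (auto simp: padic_int_simps(1) mod_pow_Suc cong_def simp del: power_Suc)

lemma padic_SucD:
  assumes "x \<in> carrier (padic_int p)"
  shows "[x (Suc n) = x n] (mod int p ^ n)"
  using assms unfolding padic_int_simps(1) cong_def by (metis mod_mod_trivial)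

lemma padic_modD:
  assumes "x \<in> carrier (padic_int p)"
  shows "x n mod int p ^ n = x n"
  using assms unfolding padic_int_simps(1) by (metis mod_mod_trivial)

lemma padic_le_eq:
  assumes "x \<in> carrier (padic_int p)" "m \<le> n"
  shows "x n mod int p ^ m = x m"
  using assms(2)
proof (induction n rule: dec_induct)
  case base
  show ?case using assms(1) by (rule padic_modD)
next
  case (step n)
  have "x (Suc n) mod int p ^ m = x (Suc n) mod int p ^ n mod int p ^ m"
    using step.hyps by (simp add: mod_mod_cancel le_imp_power_dvd)
  also have "\<dots> = x m"
    using padic_SucD[OF assms(1)] padic_modD[OF assms(1)] step.IH by (simp add: cong_def)
  finally show ?case .
qed

lemma padic_of_int_closed: "p > 0 \<Longrightarrow> padic_of_int p a \<in> carrier (padic_int p)"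
  unfolding padic_of_int_def by (rule padic_of_fun_closed) auto

lemma padic_int_cring:
  assumes "p > 0"
  shows "cring (padic_int p)"
proof (intro cringI abelian_groupI comm_monoidI)
  fix x y assume "x \<in> carrier (padic_int p)" "y \<in> carrier (padic_int p)"
  then show "x \<oplus>\<^bsub>padic_int p\<^esub> y \<in> carrier (padic_int p)"
    and "x \<otimes>\<^bsub>padic_int p\<^esub> y \<in> carrier (padic_int p)"
    unfolding padic_int_simps(2,3)
    by (intro padic_of_fun_closed assms cong_add cong_mult padic_SucD; simp)+
next
  show "\<zero>\<^bsub>padic_int p\<^esub> \<in> carrier (padic_int p)"
    using assms by (simp add: padic_int_simps)
  show "\<one>\<^bsub>padic_int p\<^esub> \<in> carrier (padic_int p)"
    unfolding padic_int_simps by (metis padic_of_int_closed[OF assms] padic_of_int_def padic_int_simps(1))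
next
  fix x assume x: "x \<in> carrier (padic_int p)"
  show "\<exists>y\<in>carrier (padic_int p). y \<oplus>\<^bsub>padic_int p\<^esub> x = \<zero>\<^bsub>padic_int p\<^esub>"
  proof
    show "(\<lambda>n. (- x n) mod int p ^ n) \<in> carrier (padic_int p)"
      by (intro padic_of_fun_closed assms) (simp add: cong_minus_minus_iff padic_SucD[OF x])
  qed (simp add: padic_int_simps mod_simps)
qed (auto simp: padic_int_simps(2-5) padic_modD mod_simps algebra_simps)

lemma continuous_on_padic_iff:
  "continuous_on (carrier (padic_int p)) (g :: (nat \<Rightarrow> int) \<Rightarrow> nat \<Rightarrow> int) \<longleftrightarrow>
     (\<forall>x\<in>carrier (padic_int p). \<forall>m. \<exists>n. \<forall>y\<in>carrier (padic_int p). y n = x n \<longrightarrow> g y m = g x m)"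
    (is "?L \<longleftrightarrow> ?R")
proof
  assume ?L
  show ?R
  proof (intro ballI allI)
    fix x m assume x: "x \<in> carrier (padic_int p)"
    have "continuous_on (carrier (padic_int p)) (\<lambda>x. g x m)"
      using \<open>?L\<close> by (rule continuous_on_product_then_coordinatewise)
    moreover have "open {g x m}" by (rule open_discrete)
    ultimately obtain A where A: "open A" "x \<in> A"
        "\<And>y. y \<in> carrier (padic_int p) \<Longrightarrow> y \<in> A \<Longrightarrow> g y m = g x m"
      using x unfolding continuous_on_topological by (metis singleton_iff)
    from A(1) have "openin (product_topology (\<lambda>i. euclidean) UNIV) A"
      by (simp add: open_fun_def)
    then obtain X where X: "x \<in> (\<Pi>\<^sub>E i\<in>UNIV. X i)" "finite {i. X i \<noteq> (UNIV :: int set)}"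
        "(\<Pi>\<^sub>E i\<in>UNIV. X i) \<subseteq> A"
      using product_topology_open_contains_basis[OF _ A(2)] by force
    obtain n where n: "\<And>i. X i \<noteq> UNIV \<Longrightarrow> i \<le> n"
      using X(2) unfolding finite_nat_set_iff_bounded_le by blast
    have "g y m = g x m" if y: "y \<in> carrier (padic_int p)" "y n = x n" for y
    proof (rule A(3)[OF y(1)])
      have "y i \<in> X i" for i
      proof (cases "X i = UNIV")
        case False
        then have "i \<le> n" by (rule n)
        then have "y i = x i"
          using padic_le_eq[OF x] padic_le_eq[OF y(1)] y(2) by metis
        then show ?thesis using X(1) by auto
      qed auto
      then show "y \<in> A" using X(3) by auto
    qed
    then show "\<exists>n. \<forall>y\<in>carrier (padic_int p). y n = x n \<longrightarrow> g y m = g x m" by blast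
  qed
next
  assume R: ?R
  show ?L
  proof (rule continuous_on_coordinatewise_then_product, unfold continuous_on_topological, safe)
    fix m x B assume x: "x \<in> carrier (padic_int p)" and B: "g x m \<in> B"
    from R x obtain n where
      n: "\<And>y. y \<in> carrier (padic_int p) \<Longrightarrow> y n = x n \<Longrightarrow> g y m = g x m" by metis
    have "open ((\<lambda>y :: nat \<Rightarrow> int. y n) -` {x n})"
      by (intro open_vimage open_discrete continuous_on_product_coordinates)
    then show "\<exists>A. open A \<and> x \<in> A \<and> (\<forall>y\<in>carrier (padic_int p). y \<in> A \<longrightarrow> g y m \<in> B)"
      using n B by (intro exI[of _ "(\<lambda>y :: nat \<Rightarrow> int. y n) -` {x n}"]) auto
  qed
qed

lemma padic_of_rat_eq:
  assumes "prime p" "quotient_of q = (a, b)" "coprime b (int p)"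
  shows "padic_of_rat p q \<in> carrier (padic_int p)"
    and "padic_of_int p b \<otimes>\<^bsub>padic_int p\<^esub> padic_of_rat p q = padic_of_int p a"
proof -
  interpret cring "padic_int p" using assms(1) by (intro padic_int_cring prime_gt_0_nat)
  have p: "p > 0" using assms(1) by (rule prime_gt_0_nat)
  have "\<exists>c. [b * c = 1] (mod int p ^ n)" for n
    using assms(3) by (intro cong_solve_coprime_int) auto
  then obtain c where c: "\<And>n. [b * c n = 1] (mod int p ^ n)" by metis
  have "[c (Suc n) = c n] (mod int p ^ n)" for n
  proof -
    have "[b * c (Suc n) = 1] (mod int p ^ n)"
      by (rule cong_dvd_modulus[OF c[of "Suc n"]]) (simp add: le_imp_power_dvd)
    then have "[b * c (Suc n) = b * c n] (mod int p ^ n)"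
      using c[of n] cong_sym cong_trans by blast
    then show ?thesis using assms(3) by (subst (asm) cong_mult_lcancel) auto
  qed
  then have c_closed: "(\<lambda>n. c n mod int p ^ n) \<in> carrier (padic_int p)"
    by (intro padic_of_fun_closed p)
  moreover have bc: "padic_of_int p b \<otimes>\<^bsub>padic_int p\<^esub> (\<lambda>n. c n mod int p ^ n) = \<one>\<^bsub>padic_int p\<^esub>"
    using c by (simp add: padic_of_int_def padic_int_simps(2,4) mod_simps cong_def)
  ultimately have u: "padic_of_int p b \<in> Units (padic_int p)"
    using padic_of_int_closed[OF p, of b] unfolding Units_def
    by (auto intro!: bexI[of _ "\<lambda>n. c n mod int p ^ n"] simp: m_comm)
  show "padic_of_rat p q \<in> carrier (padic_int p)"
    using u p by (simp add: padic_of_rat_def assms(2) padic_of_int_closed)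
  show "padic_of_int p b \<otimes>\<^bsub>padic_int p\<^esub> padic_of_rat p q = padic_of_int p a"
    using u p by (simp add: padic_of_rat_def assms(2) padic_of_int_closed m_lcomm)
qed

lemma padic_cong_iff:
  assumes "p > 0"
  shows "padic_cong p r x y \<longleftrightarrow>
    x \<in> carrier (padic_int p) \<and> y \<in> carrier (padic_int p) \<and> x r = y r"
    (is "_ \<longleftrightarrow> ?R")
proof -
  interpret cring "padic_int p" using assms by (rule padic_int_cring)
  let ?P = "padic_of_int p (int p ^ r)"
  have "x \<ominus>\<^bsub>padic_int p\<^esub> y \<in> PIdl\<^bsub>padic_int p\<^esub> ?P \<longleftrightarrow> x r = y r"
    if xy: "x \<in> carrier (padic_int p)" "y \<in> carrier (padic_int p)"
  proof
    assume "x \<ominus>\<^bsub>padic_int p\<^esub> y \<in> PIdl\<^bsub>padic_int p\<^esub> ?P"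
    then obtain z where z: "z \<in> carrier (padic_int p)"
        "x \<ominus>\<^bsub>padic_int p\<^esub> y = z \<otimes>\<^bsub>padic_int p\<^esub> ?P"
      unfolding cgenideal_def by auto
    have "x = (x \<ominus>\<^bsub>padic_int p\<^esub> y) \<oplus>\<^bsub>padic_int p\<^esub> y"
      using xy by (simp add: a_minus_def a_assoc l_neg)
    then have "x = z \<otimes>\<^bsub>padic_int p\<^esub> ?P \<oplus>\<^bsub>padic_int p\<^esub> y" using z(2) by simp
    then have "x r = (z r * (int p ^ r mod int p ^ r) mod int p ^ r + y r) mod int p ^ r"
      by (simp add: padic_int_simps(2,3) padic_of_int_def fun_eq_iff)
    then show "x r = y r" using padic_modD[OF xy(2)] by simp
  next
    assume eq: "x r = y r"
    define w where "w n = (x (n + r) - y (n + r)) div int p ^ r" for n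
    have w: "x (n + r) - y (n + r) = int p ^ r * w n" for n
    proof -
      have "(x (n + r) - y (n + r)) mod int p ^ r = 0"
        using padic_le_eq[OF xy(1), of r "n + r"] padic_le_eq[OF xy(2), of r "n + r"] eq
        by (metis mod_diff_eq diff_self mod_0 le_add2)
      then show ?thesis by (auto simp: w_def)
    qed
    have "[w (Suc n) = w n] (mod int p ^ n)" for n
    proof -
      have "[x (Suc n + r) - y (Suc n + r) = x (n + r) - y (n + r)] (mod int p ^ (n + r))"
        using padic_SucD[OF xy(1)] padic_SucD[OF xy(2)] by (intro cong_diff) auto
      then have "int p ^ r * int p ^ n dvd int p ^ r * (w (Suc n) - w n)"
        unfolding w cong_iff_dvd_diff by (simp add: power_add algebra_simps)
      then show ?thesis using assms by (simp add: cong_iff_dvd_diff)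
    qed
    then have wc: "(\<lambda>n. w n mod int p ^ n) \<in> carrier (padic_int p)"
      by (intro padic_of_fun_closed assms)
    have "x = (\<lambda>n. w n mod int p ^ n) \<otimes>\<^bsub>padic_int p\<^esub> ?P \<oplus>\<^bsub>padic_int p\<^esub> y"
    proof
      fix n
      have "x n = x (n + r) mod int p ^ n" using padic_le_eq[OF xy(1)] by simp
      also have "x (n + r) = w n * int p ^ r + y (n + r)" using w[of n] by (simp add: algebra_simps)
      also have "\<dots> mod int p ^ n = (w n * int p ^ r + y (n + r) mod int p ^ n) mod int p ^ n"
        by (simp add: mod_simps)
      also have "y (n + r) mod int p ^ n = y n" using padic_le_eq[OF xy(2)] by simp
      finally show "x n = ((\<lambda>n. w n mod int p ^ n) \<otimes>\<^bsub>padic_int p\<^esub> ?P \<oplus>\<^bsub>padic_int p\<^esub> y) n"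
        by (simp add: padic_int_simps(2,3) padic_of_int_def mod_simps)
    qed
    then have "x \<ominus>\<^bsub>padic_int p\<^esub> y = (\<lambda>n. w n mod int p ^ n) \<otimes>\<^bsub>padic_int p\<^esub> ?P"
      using wc xy padic_of_int_closed[OF assms] by (simp add: a_minus_def a_assoc r_neg)
    then show "x \<ominus>\<^bsub>padic_int p\<^esub> y \<in> PIdl\<^bsub>padic_int p\<^esub> ?P"
      using wc unfolding cgenideal_def by auto
  qed
  then show ?thesis unfolding padic_cong_def by blast
qed

end

theory Submission
  imports Defs
begin

text \<open>
  Let n = (p - 1) / 2. Modulo p^2 the weights binom(2k,k)^3 / 64^k agree with
  t(n,k) = (-1)^k binom(n,k) binom(n+k,k) binom(2k,k) / 4^k, because
  (n - j) (n + 1 + j) = (p^2 - (2j+1)^2) / 4. Zeilberger's relation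
  n^2 t(n,k) - (n-1)^2 t(n-2,k) = G(k+1) - G(k), summed by parts against harmonic numbers, yields exact
  recurrences in n. For even n they give c H_n and c (sum of (-1)^j / j^2) with c = (binom(n,n/2) / 2^n)^2.
  For odd n the sum with H_k^(2) is again a product, while the sum U with H_k has no closed form; but
  U is half of the sum with odd harmonic numbers and twice the sum with H_{n+k}, and these two differ modulo p^2
  by p/2 times a second-order sum, which the reflection k -> n - k evaluates. This is where
  the factor p/3 comes from.

  Finally 1/4 is congruent to (3p^2 + 1) / 4 modulo p^2, so Gamma_p(1/4) is a product of residues that
  is compared with the factorials in the closed forms, and the Euler numbers arise from alternating power
  sums, 1/j^2 being congruent to 2 j^(p-3) - j^(2p-4) modulo p^2.
\<close>

section \<open>Sums against the shifted Legendre coefficients\<close>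

text \<open>The obstacle is the first-order terms. Modulo p^2 the Wilson quotient, the Fermat
  quotient of 2 and harmonic numbers all enter as factors 1 + p a and have to cancel. The Wilson
  quotient disappears because w = -(p-1)! satisfies w^p = 1 modulo p^2, and because the base-p
  digits of (3p^2 + 1) / 4 make the power of w inside the fourth power of Gamma_p(1/4) fall short of
  w^(3p) by only one or three factors. The other corrections match through the congruences 2 H_{n
  div 2} = 3 H_n = -6 q modulo p, where q is the Fermat quotient; the power 2^(p-1) = 1 + p q that
  they require is supplied by the 16^m in the closed forms. Since H_n itself is a factor of the
  first sum for even n, it must be known modulo p^2 in terms of q, and this takes 2^(p-1) modulo
  p^3.

  All of this is done in the localization of the integers at p, inside the rationals. The p-adic
  integers enter only through their components modulo p^2.\<close>

lemma gen_harm_0 [simp]: "gen_harm r 0 = 0"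
  by (simp add: gen_harm_def)

lemma gen_harm_Suc [simp]: "gen_harm r (Suc k) = gen_harm r k + 1 / of_nat (Suc k) ^ r"
  by (simp add: gen_harm_def)

text \<open>The terms are 1 / (j + 1/2)^r. As n = (p - 1) / 2 is -1/2 modulo p, they arise by
  reflecting the last terms of \<open>gen_harm r n\<close>, and for r = 1 as leading terms of 1 / (n
  + 1 + j).\<close>

definition odd_harm :: "nat \<Rightarrow> nat \<Rightarrow> rat" where
  "odd_harm r k = (\<Sum>j<k. (2 / (2 * of_nat j + 1)) ^ r)"

text \<open>For x = n this is (-1)^k binom(n,k) binom(n+k,k) binom(2k,k) / 4^k.\<close>

definition legendre_coeff :: "rat \<Rightarrow> nat \<Rightarrow> rat" where
  "legendre_coeff x k = (\<Prod>j<k. - ((x - of_nat j) * (x + 1 + of_nat j) * (2 * of_nat j + 1))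
     / (2 * (of_nat j + 1) ^ 3))"

text \<open>The common factor of the coefficients for x, x - 1 and x - 2 that leaves only polynomial cofactors
  (see \<open>legendre_coeff_contiguous\<close>); junk for x = 0 and x = 1.\<close>

definition contiguous_coeff :: "rat \<Rightarrow> nat \<Rightarrow> rat" where
  "contiguous_coeff x k = (\<Prod>j<k. - ((x + of_nat j - 1) * (x - of_nat j) * (2 * of_nat j + 1))
     / (2 * (of_nat j + 1) ^ 3)) / (x * (x - 1))"

lemma legendre_coeff_0 [simp]: "legendre_coeff x 0 = 1"
  by (simp add: legendre_coeff_def)

lemma legendre_coeff_Suc:
  "legendre_coeff x (Suc k) = legendre_coeff x k *
     (- ((x - of_nat k) * (x + 1 + of_nat k) * (2 * of_nat k + 1)) / (2 * (of_nat k + 1) ^ 3))"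
  by (simp add: legendre_coeff_def)

lemma contiguous_coeff_Suc:
  "contiguous_coeff x (Suc k) = contiguous_coeff x k *
     (- ((x + of_nat k - 1) * (x - of_nat k) * (2 * of_nat k + 1)) / (2 * (of_nat k + 1) ^ 3))"
  by (simp add: contiguous_coeff_def)

lemma legendre_coeff_eq_0:
  assumes "n < k"
  shows "legendre_coeff (of_nat n) k = 0"
  unfolding legendre_coeff_def using assms by (intro prod_zero) (auto intro!: bexI[of _ n])

lemma contiguous_coeff_eq_0:
  assumes "n < k"
  shows "contiguous_coeff (of_nat n) k = 0"
proof -
  have "(\<Prod>j<k. - ((of_nat n + of_nat j - 1 :: rat) * (of_nat n - of_nat j) * (2 * of_nat j + 1))
     / (2 * (of_nat j + 1) ^ 3)) = 0"
    using assms by (intro prod_zero) (auto intro!: bexI[of _ n])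
  then show ?thesis by (simp add: contiguous_coeff_def)
qed

section \<open>Contiguous degrees and the telescoping relation\<close>

context
  fixes x :: rat
  assumes x: "x \<noteq> 0" "x \<noteq> 1"
begin

text \<open>Passing from x to x - 1 multiplies the coefficient by (x - k) / (x + k); the way back
  divides by x - k, which is 0 at k = n. Over one common factor every relation between the degrees
  is a polynomial identity valid for all k.\<close>

lemma legendre_coeff_contiguous:
  shows "legendre_coeff x k = (x + of_nat k) * (x + of_nat k - 1) * contiguous_coeff x k"
    and "legendre_coeff (x - 1) k = (x - of_nat k) * (x + of_nat k - 1) * contiguous_coeff x k"
    and "legendre_coeff (x - 2) k = (x - of_nat k) * (x - of_nat k - 1) * contiguous_coeff x k"
proof (induction k)
  case 0
  have "contiguous_coeff x 0 = 1 / (x * (x - 1))" by (simp add: contiguous_coeff_def)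
  then show "legendre_coeff x 0 = (x + of_nat 0) * (x + of_nat 0 - 1) * contiguous_coeff x 0"
    and "legendre_coeff (x - 1) 0 = (x - of_nat 0) * (x + of_nat 0 - 1) * contiguous_coeff x 0"
    and "legendre_coeff (x - 2) 0 = (x - of_nat 0) * (x - of_nat 0 - 1) * contiguous_coeff x 0"
    using x by simp_all
next
  case (Suc k)
  show "legendre_coeff x (Suc k) = (x + of_nat (Suc k)) * (x + of_nat (Suc k) - 1) * contiguous_coeff x (Suc k)"
    and "legendre_coeff (x - 1) (Suc k) = (x - of_nat (Suc k)) * (x + of_nat (Suc k) - 1) * contiguous_coeff x (Suc k)"
    and "legendre_coeff (x - 2) (Suc k) = (x - of_nat (Suc k)) * (x - of_nat (Suc k) - 1) * contiguous_coeff x (Suc k)"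
    unfolding legendre_coeff_Suc contiguous_coeff_Suc Suc
    by (simp_all add: algebra_simps)
qed

text \<open>The right-hand side G of Zeilberger's relation.\<close>

definition certificate :: "nat \<Rightarrow> rat" where
  "certificate k = - 2 * (2 * x - 1) * of_nat k ^ 3 * contiguous_coeff x k"

text \<open>The cube in the certificate cancels the denominator of the step ratio. What is left is a
  coefficient of degree \<open>x - 1\<close>; this is how sums of degree n - 1 enter the
  recurrences.\<close>

lemma certificate_Suc:
  "certificate (Suc k) = (2 * x - 1) * (2 * of_nat k + 1) * legendre_coeff (x - 1) k"
proof -
  have "(of_nat k + 1 :: rat) \<noteq> 0" by linarith
  then show ?thesis
    unfolding certificate_def contiguous_coeff_Suc legendre_coeff_contiguous(2)
    by (simp add: field_simps)
qed

lemma certificate_diff: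
  "x\<^sup>2 * legendre_coeff x k - (x - 1)\<^sup>2 * legendre_coeff (x - 2) k = certificate (Suc k) - certificate k"
  unfolding certificate_Suc legendre_coeff_contiguous
  unfolding certificate_def by (simp add: algebra_simps power2_eq_square power3_eq_cube)

end

section \<open>Recurrences in the degree, one for each weight\<close>

lemma sum_by_parts:
  fixes g f :: "nat \<Rightarrow> 'a::comm_ring"
  shows "(\<Sum>k\<le>n. (g (Suc k) - g k) * f k) =
    g (Suc n) * f (Suc n) - g 0 * f 0 - (\<Sum>k\<le>n. g (Suc k) * (f (Suc k) - f k))"
  by (induction n) (simp_all add: algebra_simps)

text \<open>There are no boundary terms: the certificate vanishes at 0 because of its cube and at
  \<open>Suc n\<close> because \<open>contiguous_coeff\<close> does.\<close>

lemma legendre_sum_recurrence: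
  fixes n :: nat and f :: "nat \<Rightarrow> rat"
  defines "x \<equiv> of_nat n"
  assumes "n \<ge> 2"
  shows "x\<^sup>2 * (\<Sum>k\<le>n. legendre_coeff x k * f k) - (x - 1)\<^sup>2 * (\<Sum>k\<le>n. legendre_coeff (x - 2) k * f k)
    = - (\<Sum>k\<le>n. certificate x (Suc k) * (f (Suc k) - f k))"
proof -
  have x: "x \<noteq> 0" "x \<noteq> 1" using assms by auto
  have "x\<^sup>2 * (\<Sum>k\<le>n. legendre_coeff x k * f k) - (x - 1)\<^sup>2 * (\<Sum>k\<le>n. legendre_coeff (x - 2) k * f k)
    = (\<Sum>k\<le>n. (x\<^sup>2 * legendre_coeff x k - (x - 1)\<^sup>2 * legendre_coeff (x - 2) k) * f k)"
    by (simp add: sum_distrib_left sum_subtractf algebra_simps)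
  also have "\<dots> = (\<Sum>k\<le>n. (certificate x (Suc k) - certificate x k) * f k)"
    using certificate_diff[OF x] by simp
  also have "\<dots> = - (\<Sum>k\<le>n. certificate x (Suc k) * (f (Suc k) - f k))"
    unfolding sum_by_parts using contiguous_coeff_eq_0[of n "Suc n"] x
    by (simp add: certificate_def x_def)
  finally show ?thesis .
qed

text \<open>The index is moved by one so that the increment 1 / k^r of a harmonic number cancels
  against k^3. In the unshifted form it is the increment 2 / (2k + 1) of \<open>odd_harm\<close>
  that cancels, against the factor in \<open>certificate_Suc\<close>.\<close>

lemma legendre_sum_recurrence':
  fixes n :: nat and f :: "nat \<Rightarrow> rat"
  defines "x \<equiv> of_nat n"
  assumes "n \<ge> 2"
  shows "x\<^sup>2 * (\<Sum>k\<le>n. legendre_coeff x k * f k) - (x - 1)\<^sup>2 * (\<Sum>k\<le>n. legendre_coeff (x - 2) k * f k)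
    = 2 * (2 * x - 1) * (\<Sum>k\<le>n. of_nat k ^ 3 * contiguous_coeff x k * (f k - f (k - 1)))"
proof -
  have x: "x \<noteq> 0" "x \<noteq> 1" using assms by auto
  have "(\<Sum>k\<le>n. certificate x (Suc k) * (f (Suc k) - f k)) =
      (\<Sum>k\<le>Suc n. certificate x k * (f k - f (k - 1)))"
    using x by (subst sum.atMost_Suc_shift) (simp add: certificate_def)
  also have "\<dots> = (\<Sum>k\<le>n. certificate x k * (f k - f (k - 1)))"
    using contiguous_coeff_eq_0[of n "Suc n"] x by (simp add: certificate_def x_def)
  also have "\<dots> = - (2 * (2 * x - 1)) * (\<Sum>k\<le>n. of_nat k ^ 3 * contiguous_coeff x k * (f k - f (k - 1)))"
    unfolding sum_distrib_left by (intro sum.cong refl) (simp add: certificate_def[OF x] mult.assoc)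
  finally show ?thesis
    unfolding legendre_sum_recurrence[OF assms(2), folded x_def] by (simp only: minus_mult_left minus_minus)
qed

definition legendre_sum :: "nat \<Rightarrow> (nat \<Rightarrow> rat) \<Rightarrow> rat" where
  "legendre_sum n f = (\<Sum>k\<le>n. legendre_coeff (of_nat n) k * f k)"

lemma legendre_sum_cutoff:
  assumes "n \<le> m"
  shows "(\<Sum>k\<le>m. legendre_coeff (of_nat n) k * f k) = legendre_sum n f"
  unfolding legendre_sum_def
  by (rule sum.mono_neutral_right) (use assms legendre_coeff_eq_0[of n] in auto)

lemma legendre_sum_shift:
  assumes "n \<ge> 2"
  shows "(\<Sum>k\<le>n. legendre_coeff (of_nat n - 2) k * f k) = legendre_sum (n - 2) f"
    and "(\<Sum>k\<le>n. legendre_coeff (of_nat n - 1) k * f k) = legendre_sum (n - 1) f"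
  using legendre_sum_cutoff[of "n - 2" n f] legendre_sum_cutoff[of "n - 1" n f] assms
  by (simp_all add: of_nat_diff)

context
  fixes n :: nat and x m0 m1 m2 :: rat
  assumes n: "n \<ge> 2"
  defines "x \<equiv> of_nat n"
  defines "m0 \<equiv> (\<Sum>k\<le>n. contiguous_coeff x k)"
  defines "m1 \<equiv> (\<Sum>k\<le>n. of_nat k * contiguous_coeff x k)"
  defines "m2 \<equiv> (\<Sum>k\<le>n. of_nat k ^ 2 * contiguous_coeff x k)"
begin

private lemma x01: "x \<noteq> 0" "x \<noteq> 1"
  using n by (auto simp: x_def)

private lemma moments:
  "(\<Sum>k\<le>n. (a + b * of_nat k + c * of_nat k ^ 2) * contiguous_coeff x k) = a * m0 + b * m1 + c * m2"
  by (simp add: m0_def m1_def m2_def sum_distrib_left sum.distrib algebra_simps)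

text \<open>Three degrees, three moments: the moment that a weight leaves behind can be translated
  back into sums with weight 1.\<close>

private lemma legendre_sum_moments:
  shows "legendre_sum n (\<lambda>_. 1) = m2 + (2 * x - 1) * m1 + x * (x - 1) * m0"
    and "legendre_sum (n - 1) (\<lambda>_. 1) = x * (x - 1) * m0 + m1 - m2"
    and "legendre_sum (n - 2) (\<lambda>_. 1) = m2 - (2 * x - 1) * m1 + x * (x - 1) * m0"
proof -
  show "legendre_sum n (\<lambda>_. 1) = m2 + (2 * x - 1) * m1 + x * (x - 1) * m0"
    using moments[of "x * (x - 1)" "2 * x - 1" 1]
    by (simp add: legendre_sum_def flip: x_def)
      (simp add: legendre_coeff_contiguous(1)[OF x01] algebra_simps power2_eq_square)
  show "legendre_sum (n - 1) (\<lambda>_. 1) = x * (x - 1) * m0 + m1 - m2"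
    using moments[of "x * (x - 1)" 1 "- 1"]
    unfolding legendre_sum_shift(2)[OF n, symmetric] x_def[symmetric] legendre_coeff_contiguous(2)[OF x01]
    by (simp add: algebra_simps power2_eq_square)
  show "legendre_sum (n - 2) (\<lambda>_. 1) = m2 - (2 * x - 1) * m1 + x * (x - 1) * m0"
    using moments[of "x * (x - 1)" "- (2 * x - 1)" 1]
    unfolding legendre_sum_shift(1)[OF n, symmetric] x_def[symmetric] legendre_coeff_contiguous(3)[OF x01]
    by (simp add: algebra_simps power2_eq_square)
qed

lemma legendre_sum_one_rec:
  "x\<^sup>2 * legendre_sum n (\<lambda>_. 1) = (x - 1)\<^sup>2 * legendre_sum (n - 2) (\<lambda>_. 1)"
  using legendre_sum_recurrence[OF n, of "\<lambda>_. 1"] legendre_sum_shift(1)[OF n, of "\<lambda>_. 1"]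
  by (simp add: x_def legendre_sum_def)

lemma legendre_sum_harm_rec:
  "x\<^sup>2 * legendre_sum n (gen_harm 1) = (x - 1)\<^sup>2 * legendre_sum (n - 2) (gen_harm 1)
     + x * legendre_sum n (\<lambda>_. 1) + (x - 1) * legendre_sum (n - 2) (\<lambda>_. 1)
     - (2 * x - 1) * legendre_sum (n - 1) (\<lambda>_. 1)"
proof -
  have "(\<Sum>k\<le>n. of_nat k ^ 3 * contiguous_coeff x k * (gen_harm 1 k - gen_harm 1 (k - 1))) = m2"
    unfolding m2_def
  proof (intro sum.cong refl)
    fix k
    show "of_nat k ^ 3 * contiguous_coeff x k * (gen_harm 1 k - gen_harm 1 (k - 1)) =
        of_nat k ^ 2 * contiguous_coeff x k"
      by (cases k) (simp_all add: power3_eq_cube power2_eq_square del: of_nat_Suc)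
  qed
  then have "x\<^sup>2 * legendre_sum n (gen_harm 1) - (x - 1)\<^sup>2 * legendre_sum (n - 2) (gen_harm 1)
      = 2 * (2 * x - 1) * m2"
    using legendre_sum_recurrence'[OF n, of "gen_harm 1", folded x_def]
      legendre_sum_shift(1)[OF n, of "gen_harm 1", folded x_def]
    by (simp only: legendre_sum_def x_def)
  then show ?thesis unfolding legendre_sum_moments by (simp add: algebra_simps)
qed

text \<open>The increment 1 / k^2 leaves \<open>m1\<close>, a multiple of the difference of degrees
  n and n - 2. Degree n - 1 does not occur, so for odd n this recurrence becomes
  homogeneous.\<close>

lemma legendre_sum_harm2_rec:
  "x\<^sup>2 * legendre_sum n (gen_harm 2) = (x - 1)\<^sup>2 * legendre_sum (n - 2) (gen_harm 2)
     + legendre_sum n (\<lambda>_. 1) - legendre_sum (n - 2) (\<lambda>_. 1)"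
proof -
  have "(\<Sum>k\<le>n. of_nat k ^ 3 * contiguous_coeff x k * (gen_harm 2 k - gen_harm 2 (k - 1))) = m1"
    unfolding m1_def
  proof (intro sum.cong refl)
    fix k
    show "of_nat k ^ 3 * contiguous_coeff x k * (gen_harm 2 k - gen_harm 2 (k - 1)) =
        of_nat k * contiguous_coeff x k"
      by (cases k) (simp_all add: power3_eq_cube power2_eq_square del: of_nat_Suc)
  qed
  then have "x\<^sup>2 * legendre_sum n (gen_harm 2) - (x - 1)\<^sup>2 * legendre_sum (n - 2) (gen_harm 2)
      = 2 * (2 * x - 1) * m1"
    using legendre_sum_recurrence'[OF n, of "gen_harm 2", folded x_def]
      legendre_sum_shift(1)[OF n, of "gen_harm 2", folded x_def]
    by (simp only: legendre_sum_def x_def)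
  then show ?thesis unfolding legendre_sum_moments by (simp add: algebra_simps)
qed

lemma legendre_sum_odd_harm_rec:
  "x\<^sup>2 * legendre_sum n (odd_harm 1) = (x - 1)\<^sup>2 * legendre_sum (n - 2) (odd_harm 1)
     - 2 * (2 * x - 1) * legendre_sum (n - 1) (\<lambda>_. 1)"
proof -
  have "certificate x (Suc k) * (odd_harm 1 (Suc k) - odd_harm 1 k) =
      2 * (2 * x - 1) * legendre_coeff (x - 1) k" for k
  proof -
    have "(2 * of_nat k + 1 :: rat) \<noteq> 0" using of_nat_0_le_iff[of k, where ?'a = rat] by linarith
    then show ?thesis
      unfolding certificate_Suc[OF x01] by (simp add: odd_harm_def field_simps)
  qed
  then have "x\<^sup>2 * legendre_sum n (odd_harm 1) - (x - 1)\<^sup>2 * legendre_sum (n - 2) (odd_harm 1)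
      = - (\<Sum>k\<le>n. 2 * (2 * x - 1) * legendre_coeff (x - 1) k)"
    using legendre_sum_recurrence[OF n, of "odd_harm 1"] legendre_sum_shift(1)[OF n, of "odd_harm 1"]
    by (simp add: x_def legendre_sum_def)
  also have "\<dots> = - (2 * (2 * x - 1) * legendre_sum (n - 1) (\<lambda>_. 1))"
    unfolding legendre_sum_shift(2)[OF n, of "\<lambda>_. 1", symmetric] x_def[symmetric]
    by (simp only: sum_distrib_left mult_1_right)
  finally show ?thesis by simp
qed

text \<open>The weight H_{n+k} itself moves with n. The recurrence is applied to the weight
  \<open>f\<close> belonging to n - 2; at degree n the missing terms 1 / (n + k - 1) and 1 / (n + k)
  are added, and the cofactors of \<open>contiguous_coeff\<close> cancel their denominators.\<close>

lemma legendre_sum_shifted_harm_rec: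
  assumes "legendre_sum n (\<lambda>_. 1) = 0" "legendre_sum (n - 2) (\<lambda>_. 1) = 0"
  shows "2 * x\<^sup>2 * legendre_sum n (\<lambda>k. gen_harm 1 (n + k)) =
    2 * (x - 1)\<^sup>2 * legendre_sum (n - 2) (\<lambda>k. gen_harm 1 (n - 2 + k))
     - (2 * x - 1) * legendre_sum (n - 1) (\<lambda>_. 1)"
proof -
  define f where "f k = gen_harm 1 (n - 2 + k)" for k
  \<comment> \<open>Difference and sum of the two vanishing sums express \<open>m1\<close> and
    \<open>m2\<close> through \<open>m0\<close>.\<close>
  have eq: "m1 = 0" "m2 = - x * (x - 1) * m0"
  proof -
    have "2 * (2 * x - 1) * m1 = legendre_sum n (\<lambda>_. 1) - legendre_sum (n - 2) (\<lambda>_. 1)"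
      unfolding legendre_sum_moments by (simp add: algebra_simps)
    moreover have "2 * x - 1 \<noteq> 0" using n by (simp add: x_def)
    ultimately show "m1 = 0" by (simp add: assms)
    have "2 * (m2 + x * (x - 1) * m0) = legendre_sum n (\<lambda>_. 1) + legendre_sum (n - 2) (\<lambda>_. 1)"
      unfolding legendre_sum_moments by (simp add: algebra_simps)
    then have "m2 + x * (x - 1) * m0 = 0" by (simp add: assms)
    then show "m2 = - x * (x - 1) * m0" by (simp only: eq_neg_iff_add_eq_0 mult_minus_left)
  qed
  have nz: "x + of_nat k \<noteq> 0" "x + of_nat k - 1 \<noteq> 0" for k
  proof -
    have "x \<ge> 2" using n by (simp add: x_def)
    then show "x + of_nat k \<noteq> 0" "x + of_nat k - 1 \<noteq> 0"
      using of_nat_0_le_iff[of k, where ?'a = rat] by linarith+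
  qed
  obtain n' where n': "n = Suc (Suc n')" using n by (metis add_2_eq_Suc le_Suc_ex)
  have f_Suc: "f (Suc k) - f k = 1 / (x + of_nat k - 1)" for k
    by (simp add: f_def n' x_def algebra_simps)
  have f_n: "gen_harm 1 (n + k) = f k + 1 / (x + of_nat k - 1) + 1 / (x + of_nat k)" for k
    by (simp add: f_def n' x_def algebra_simps)
  have "certificate x (Suc k) * (f (Suc k) - f k) =
      (2 * x - 1) * ((x + (2 * x - 1) * of_nat k + (- 2) * of_nat k ^ 2) * contiguous_coeff x k)" for k
    unfolding certificate_Suc[OF x01] f_Suc legendre_coeff_contiguous(2)[OF x01]
    using nz(2)[of k] by (simp add: field_simps power2_eq_square)
  then have 1: "x\<^sup>2 * (\<Sum>k\<le>n. legendre_coeff x k * f k) - (x - 1)\<^sup>2 * legendre_sum (n - 2) f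
      = - ((2 * x - 1) * (x * m0 + (2 * x - 1) * m1 + (- 2) * m2))"
    unfolding moments[symmetric]
    using legendre_sum_recurrence[OF n, of f] legendre_sum_shift(1)[OF n, of f]
    by (simp add: x_def sum_distrib_left)
  have *: "a * b * c * (d + 1 / b + 1 / a) = a * b * c * d + (a + b) * c"
    if "a \<noteq> 0" "b \<noteq> 0" for a b c d :: rat
    using that by (simp add: field_simps)
  have "legendre_coeff x k * gen_harm 1 (n + k) = legendre_coeff x k * f k
      + (2 * x - 1 + 2 * of_nat k + 0 * of_nat k ^ 2) * contiguous_coeff x k" for k
    unfolding f_n legendre_coeff_contiguous(1)[OF x01] *[OF nz] by simp
  then have 2: "legendre_sum n (\<lambda>k. gen_harm 1 (n + k)) =
      (\<Sum>k\<le>n. legendre_coeff x k * f k) + ((2 * x - 1) * m0 + 2 * m1 + 0 * m2)"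
    unfolding moments[symmetric] by (simp add: legendre_sum_def sum.distrib flip: x_def)
  show ?thesis
    unfolding 2 legendre_sum_moments f_def[symmetric]
    using 1 unfolding eq by (simp add: algebra_simps power2_eq_square)
qed

end

section \<open>Closed forms and proportional sums\<close>

text \<open>The claims are proved together: the vanishing in odd degree removes the n - 1 term from
  the recurrence for H_k. What remains is solved by \<open>c\<close> times a partial sum whose two
  new terms produce the inhomogeneity.\<close>

lemma legendre_sum_even:
  fixes m :: nat
  defines "c \<equiv> (\<Prod>j=1..m. (2 * of_nat j - 1) / (2 * of_nat j) :: rat)\<^sup>2"
  shows "legendre_sum (2 * m) (\<lambda>_. 1) = c"
    and "legendre_sum (Suc (2 * m)) (\<lambda>_. 1) = 0"
    and "legendre_sum (2 * m) (gen_harm 1) = c * gen_harm 1 (2 * m)"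
    and "legendre_sum (2 * m) (gen_harm 2) = c * (\<Sum>j=1..2*m. (- 1) ^ j / of_nat j ^ 2)"
  unfolding c_def
proof (induction m)
  case 0
  show "legendre_sum (2 * 0) (\<lambda>_. 1) = (\<Prod>j=1..0. (2 * of_nat j - 1) / (2 * of_nat j) :: rat)\<^sup>2"
    "legendre_sum (2 * 0) (gen_harm 1) = (\<Prod>j=1..0. (2 * of_nat j - 1) / (2 * of_nat j) :: rat)\<^sup>2 * gen_harm 1 (2 * 0)"
    "legendre_sum (2 * 0) (gen_harm 2) = (\<Prod>j=1..0. (2 * of_nat j - 1) / (2 * of_nat j) :: rat)\<^sup>2 * (\<Sum>j=1..2*0. (- 1) ^ j / of_nat j ^ 2)"
    by (simp_all add: legendre_sum_def)
  show "legendre_sum (Suc (2 * 0)) (\<lambda>_. 1) = 0"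
    by (simp add: legendre_sum_def legendre_coeff_Suc)
next
  case (Suc m)
  define c where "c = (\<Prod>j=1..m. (2 * of_nat j - 1) / (2 * of_nat j) :: rat)\<^sup>2"
  define c' where "c' = (\<Prod>j=1..Suc m. (2 * of_nat j - 1) / (2 * of_nat j) :: rat)\<^sup>2"
  define y :: rat where "y = of_nat m"
  have y: "2 * y + 2 \<noteq> 0" "2 * y + 3 \<noteq> 0" "y + 1 \<noteq> 0" "2 * y + 1 \<noteq> 0"
    using of_nat_0_le_iff[of m, where ?'a = rat] unfolding y_def by linarith+
  have "c' = c * ((2 * y + 1) / (2 * y + 2))\<^sup>2"
    unfolding c_def c'_def power_mult_distrib[symmetric] by (simp add: y_def algebra_simps)
  then have c': "(2 * y + 2)\<^sup>2 * c' = (2 * y + 1)\<^sup>2 * c"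
    using y(1) by (simp add: power_divide)
  note IH = Suc[folded c_def]
  let ?n = "2 * Suc m"
  have n: "?n \<ge> 2" "Suc ?n \<ge> 2" by simp_all
  have S: "legendre_sum ?n (\<lambda>_. 1) = c'"
  proof -
    have "(2 * y + 2)\<^sup>2 * legendre_sum ?n (\<lambda>_. 1) = (2 * y + 2)\<^sup>2 * c'"
      using legendre_sum_one_rec[OF n(1)] IH(1) unfolding c' by (simp add: y_def algebra_simps)
    then show ?thesis using y(1) by simp
  qed
  show "legendre_sum ?n (\<lambda>_. 1) = (\<Prod>j=1..Suc m. (2 * of_nat j - 1) / (2 * of_nat j) :: rat)\<^sup>2"
    using S unfolding c'_def .
  show "legendre_sum (Suc ?n) (\<lambda>_. 1) = 0"
  proof -
    have "(2 * y + 3)\<^sup>2 * legendre_sum (Suc ?n) (\<lambda>_. 1) = 0"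
      using legendre_sum_one_rec[OF n(2)] IH(2) by (simp add: y_def algebra_simps)
    then show ?thesis using y(2) by simp
  qed
  have "(2 * y + 2)\<^sup>2 * legendre_sum ?n (gen_harm 1) = (2 * y + 1)\<^sup>2 * (c * gen_harm 1 (2 * m))
      + (2 * y + 2) * c' + (2 * y + 1) * c"
    using legendre_sum_harm_rec[OF n(1)] IH(1-3) S by (simp add: y_def algebra_simps)
  moreover have "gen_harm 1 ?n = gen_harm 1 (2 * m) + 1 / (2 * y + 1) + 1 / (2 * y + 2)"
    by (simp add: y_def algebra_simps)
  moreover have "(2 * y + 2)\<^sup>2 * (c' * (g + 1 / (2 * y + 1) + 1 / (2 * y + 2))) =
      (2 * y + 1)\<^sup>2 * (c * g) + (2 * y + 2) * c' + (2 * y + 1) * c" for g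
  proof -
    have *: "e\<^sup>2 * (b * (a + 1 / e)) = e\<^sup>2 * b * a + e * b" if "e \<noteq> 0" for a b e :: rat
      using that by (simp add: field_simps power2_eq_square)
    show ?thesis
      unfolding *[OF y(1)] c' using *[OF y(4), of c g] by simp
  qed
  ultimately have "(2 * y + 2)\<^sup>2 * legendre_sum ?n (gen_harm 1) = (2 * y + 2)\<^sup>2 * (c' * gen_harm 1 ?n)"
    by (simp only:)
  then show "legendre_sum ?n (gen_harm 1) = (\<Prod>j=1..Suc m. (2 * of_nat j - 1) / (2 * of_nat j) :: rat)\<^sup>2 * gen_harm 1 ?n"
    using y(1) by (simp add: c'_def)
  have "(2 * y + 2)\<^sup>2 * legendre_sum ?n (gen_harm 2) =
      (2 * y + 1)\<^sup>2 * (c * (\<Sum>j=1..2*m. (- 1) ^ j / of_nat j ^ 2)) + c' - c"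
    using legendre_sum_harm2_rec[OF n(1)] IH(1,4) S by (simp add: y_def algebra_simps)
  moreover have "(\<Sum>j=1..?n. (- 1) ^ j / of_nat j ^ 2) = (\<Sum>j=1..2*m. (- 1) ^ j / of_nat j ^ 2)
      - 1 / (2 * y + 1)\<^sup>2 + 1 / (2 * y + 2)\<^sup>2"
    by (simp add: y_def algebra_simps)
  moreover have "(2 * y + 2)\<^sup>2 * (c' * (g - 1 / (2 * y + 1)\<^sup>2 + 1 / (2 * y + 2)\<^sup>2)) =
      (2 * y + 1)\<^sup>2 * (c * g) + c' - c" for g
  proof -
    have "(2 * y + 2)\<^sup>2 * (c' * (g - 1 / (2 * y + 1)\<^sup>2 + 1 / (2 * y + 2)\<^sup>2)) =
        (2 * y + 2)\<^sup>2 * c' * (g - 1 / (2 * y + 1)\<^sup>2) + c'"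
      using y by (simp add: distrib_left)
    then show ?thesis unfolding c' using y by (simp add: right_diff_distrib)
  qed
  ultimately have "(2 * y + 2)\<^sup>2 * legendre_sum ?n (gen_harm 2) =
      (2 * y + 2)\<^sup>2 * (c' * (\<Sum>j=1..?n. (- 1) ^ j / of_nat j ^ 2))"
    by (simp only:)
  then show "legendre_sum ?n (gen_harm 2) = (\<Prod>j=1..Suc m. (2 * of_nat j - 1) / (2 * of_nat j) :: rat)\<^sup>2 *
      (\<Sum>j=1..?n. (- 1) ^ j / of_nat j ^ 2)"
    using y(1) by (simp add: c'_def)
qed

text \<open>In odd degree the weight-1 sums of degrees n and n - 2 vanish, that of degree n - 1 does
  not. It is absent from the recurrence for \<open>gen_harm 2\<close>, which therefore has a product
  solution. For the other three weights it is the only inhomogeneity, with coefficients in the ratio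
  1 : 2 : 1/2, and the values at n = 1 have the same ratio.\<close>

lemma legendre_sum_odd:
  fixes m :: nat
  defines "n \<equiv> Suc (2 * m)"
  shows "legendre_sum n (gen_harm 2) = - (\<Prod>j=1..m. 2 * of_nat j / (2 * of_nat j + 1))\<^sup>2"
    and "legendre_sum n (odd_harm 1) = 2 * legendre_sum n (gen_harm 1)"
    and "2 * legendre_sum n (\<lambda>k. gen_harm 1 (n + k)) = legendre_sum n (gen_harm 1)"
  unfolding n_def
proof (induction m)
  case 0
  show "legendre_sum (Suc (2 * 0)) (gen_harm 2) = - (\<Prod>j=1..0. 2 * of_nat j / (2 * of_nat j + 1))\<^sup>2"
    "legendre_sum (Suc (2 * 0)) (odd_harm 1) = 2 * legendre_sum (Suc (2 * 0)) (gen_harm 1)"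
    "2 * legendre_sum (Suc (2 * 0)) (\<lambda>k. gen_harm 1 (Suc (2 * 0) + k)) = legendre_sum (Suc (2 * 0)) (gen_harm 1)"
    by (simp_all add: legendre_sum_def legendre_coeff_Suc odd_harm_def)
next
  case (Suc m)
  let ?n = "Suc (2 * Suc m)"
  have n: "?n \<ge> 2" by simp
  define y :: rat where "y = of_nat m"
  have y: "2 * y + 3 \<noteq> 0"
    using of_nat_0_le_iff[of m, where ?'a = rat] unfolding y_def by linarith
  have z: "legendre_sum ?n (\<lambda>_. 1) = 0" "legendre_sum (?n - 2) (\<lambda>_. 1) = 0"
    using legendre_sum_even(2)[of "Suc m"] legendre_sum_even(2)[of m] by simp_all
  have n2: "?n - 2 = Suc (2 * m)" "(of_nat ?n :: rat) = 2 * y + 3" "2 * y + 3 - 1 = 2 * y + 2"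
    by (simp_all add: y_def)
  note r = legendre_sum_harm_rec[OF n] legendre_sum_harm2_rec[OF n] legendre_sum_odd_harm_rec[OF n]
    legendre_sum_shifted_harm_rec[OF n z]
  note r' = r[unfolded n2, unfolded z[unfolded n2]]
  have "(2 * y + 3)\<^sup>2 * legendre_sum ?n (gen_harm 2) = (2 * y + 3)\<^sup>2 *
    (- (\<Prod>j=1..Suc m. 2 * of_nat j / (2 * of_nat j + 1))\<^sup>2)"
  proof -
    have "(\<Prod>j=1..Suc m. 2 * of_nat j / (2 * of_nat j + 1)) =
        (\<Prod>j=1..m. 2 * of_nat j / (2 * of_nat j + 1)) * ((2 * y + 2) / (2 * y + 3))"
      by (simp add: y_def algebra_simps)
    then show ?thesis
      unfolding r'(2) Suc(1) using y
      by (simp only: power_mult_distrib power_divide) simp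
  qed
  then show "legendre_sum ?n (gen_harm 2) = - (\<Prod>j=1..Suc m. 2 * of_nat j / (2 * of_nat j + 1))\<^sup>2"
    using y by (simp only: mult_cancel_left power_eq_0_iff) simp
  have "(2 * y + 3)\<^sup>2 * legendre_sum ?n (odd_harm 1) = (2 * y + 3)\<^sup>2 * (2 * legendre_sum ?n (gen_harm 1))"
    using r'(1) r'(3)[unfolded Suc(2)] by linarith
  then show "legendre_sum ?n (odd_harm 1) = 2 * legendre_sum ?n (gen_harm 1)" using y by simp
  have "(2 * y + 3)\<^sup>2 * (2 * legendre_sum ?n (\<lambda>k. gen_harm 1 (?n + k))) = (2 * y + 3)\<^sup>2 * legendre_sum ?n (gen_harm 1)"
  proof -
    have "2 * (2 * y + 2)\<^sup>2 * legendre_sum (Suc (2 * m)) (\<lambda>k. gen_harm 1 (Suc (2 * m) + k)) =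
        (2 * y + 2)\<^sup>2 * legendre_sum (Suc (2 * m)) (gen_harm 1)"
      unfolding Suc(3)[symmetric] by simp
    then show ?thesis using r'(1,4) by linarith
  qed
  then show "2 * legendre_sum ?n (\<lambda>k. gen_harm 1 (?n + k)) = legendre_sum ?n (gen_harm 1)"
    using y by simp
qed

section \<open>Congruences between p-integral rationals\<close>

declare One_nat_def [simp del]

text \<open>The localization of the integers at p. Fractions need not be reduced, which keeps the
  closure proofs free of gcds.\<close>

definition p_integral :: "nat \<Rightarrow> rat set" where
  "p_integral p = {x. \<exists>a b. coprime b (int p) \<and> x = of_int a / of_int b}"

text \<open>Neither side is assumed to be p-integral, so a congruence can serve to prove
  integrality, as in \<open>cg_Z\<close>.\<close>

definition rat_cong :: "nat \<Rightarrow> nat \<Rightarrow> rat \<Rightarrow> rat \<Rightarrow> bool" where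
  "rat_cong p r x y \<longleftrightarrow> (x - y) / of_nat p ^ r \<in> p_integral p"

locale prime_gt_3 =
  fixes p n :: nat
  assumes prime_p: "prime p" and p_gt_3: "p > 3" and p_n: "p = 2 * n + 1"
begin

abbreviation Z :: "rat set" where "Z \<equiv> p_integral p"
abbreviation cg :: "nat \<Rightarrow> rat \<Rightarrow> rat \<Rightarrow> bool" where "cg \<equiv> rat_cong p"
abbreviation P :: rat where "P \<equiv> of_nat p"

lemma p_pos [simp]: "p > 0" "p \<noteq> 0"
  using p_gt_3 by simp_all

lemma coprime_nz: "coprime b (int p) \<Longrightarrow> b \<noteq> 0"
  using p_gt_3 by auto

lemma Z_I: "coprime b (int p) \<Longrightarrow> x = of_int a / of_int b \<Longrightarrow> x \<in> Z"
  unfolding p_integral_def by blast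

lemma Z_of_int [simp]: "of_int a \<in> Z"
  by (rule Z_I[of 1 _ a]) simp_all

lemma Z_of_nat [simp]: "of_nat a \<in> Z"
  using Z_of_int[of "int a"] by simp

lemma Z_numeral [simp]: "numeral a \<in> Z" "0 \<in> Z" "1 \<in> Z"
  using Z_of_int[of "numeral a"] Z_of_int[of 0] Z_of_int[of 1] by simp_all

lemma Z_mult [simp]: "x \<in> Z \<Longrightarrow> y \<in> Z \<Longrightarrow> x * y \<in> Z"
proof -
  assume "x \<in> Z" "y \<in> Z"
  then obtain a b c d where "coprime b (int p)" "x = of_int a / of_int b"
      "coprime d (int p)" "y = of_int c / of_int d"
    unfolding p_integral_def by auto
  then show ?thesis by (intro Z_I[of "b * d" _ "a * c"]) simp_all
qed

lemma Z_add [simp]: "x \<in> Z \<Longrightarrow> y \<in> Z \<Longrightarrow> x + y \<in> Z"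
proof -
  assume "x \<in> Z" "y \<in> Z"
  then obtain a b c d where *: "coprime b (int p)" "x = of_int a / of_int b"
      "coprime d (int p)" "y = of_int c / of_int d"
    unfolding p_integral_def by auto
  have "x + y = of_int (a * d + c * b) / of_int (b * d)"
    using * coprime_nz[of b] coprime_nz[of d] by (simp add: field_simps)
  moreover have "coprime (b * d) (int p)" using * by simp
  ultimately show ?thesis by (intro Z_I)
qed

lemma Z_minus [simp]: "x \<in> Z \<Longrightarrow> - x \<in> Z"
  using Z_mult[OF Z_of_int[of "- 1"], of x] by simp

lemma Z_diff [simp]: "x \<in> Z \<Longrightarrow> y \<in> Z \<Longrightarrow> x - y \<in> Z"
  using Z_add[of x "- y"] by simp

lemma Z_power [simp]: "x \<in> Z \<Longrightarrow> x ^ k \<in> Z"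
  by (induction k) auto

lemma Z_sum [simp]: "(\<And>i. i \<in> A \<Longrightarrow> f i \<in> Z) \<Longrightarrow> sum f A \<in> Z"
  by (induction A rule: infinite_finite_induct) auto

lemma Z_prod [simp]: "(\<And>i. i \<in> A \<Longrightarrow> f i \<in> Z) \<Longrightarrow> prod f A \<in> Z"
  by (induction A rule: infinite_finite_induct) auto

lemma Z_divide: "x \<in> Z \<Longrightarrow> coprime k p \<Longrightarrow> x / of_nat k \<in> Z"
proof -
  assume "x \<in> Z" "coprime k p"
  moreover have "1 / of_nat k \<in> Z"
    using \<open>coprime k p\<close> by (intro Z_I[of "int k" _ 1]) simp_all
  ultimately show ?thesis using Z_mult[of x "1 / of_nat k"] by simp
qed

lemma coprime_less: "0 < k \<Longrightarrow> k < p \<Longrightarrow> coprime k p"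
  using prime_p by (metis coprime_commute nat_dvd_not_less prime_imp_coprime)

lemma coprime_23: "coprime 2 p" "coprime 3 p" "coprime 4 p" "coprime 8 p"
proof -
  show 2: "coprime 2 p" and "coprime 3 p" by (rule coprime_less; use p_gt_3 in simp)+
  show "coprime 4 p" "coprime 8 p"
    using coprime_power_left_iff[of 2 2 p] coprime_power_left_iff[of 2 3 p] 2 by simp_all
qed

lemma Z_div_numeral [simp]: "x \<in> Z \<Longrightarrow> x / 2 \<in> Z" "x \<in> Z \<Longrightarrow> x / 3 \<in> Z" "x \<in> Z \<Longrightarrow> x / 4 \<in> Z"
    "x \<in> Z \<Longrightarrow> x / 8 \<in> Z"
  using coprime_23 Z_divide[of x 2] Z_divide[of x 3] Z_divide[of x 4] Z_divide[of x 8] by simp_all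

lemma Z_gen_harm [simp]: "k < p \<Longrightarrow> gen_harm r k \<in> Z"
  unfolding gen_harm_def of_nat_power[symmetric]
  by (intro Z_sum Z_divide) (auto intro!: coprime_less)

lemma cg_refl [simp]: "cg r x x"
  by (simp add: rat_cong_def)

lemma cg_minus: "cg r x y \<Longrightarrow> cg r (- x) (- y)"
  unfolding rat_cong_def using Z_minus by (metis minus_diff_minus minus_divide_left)

lemma cg_sym: "cg r x y \<Longrightarrow> cg r y x"
  unfolding rat_cong_def using Z_minus by (metis minus_diff_eq minus_divide_left)

lemma cg_add: "cg r x x' \<Longrightarrow> cg r y y' \<Longrightarrow> cg r (x + y) (x' + y')"
  unfolding rat_cong_def using Z_add by (metis add_diff_add add_divide_distrib)

lemma cg_diff: "cg r x x' \<Longrightarrow> cg r y y' \<Longrightarrow> cg r (x - y) (x' - y')"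
  using cg_add[of r x x' "- y" "- y'"] cg_minus by simp

lemma cg_trans [trans]: "cg r x y \<Longrightarrow> cg r y z \<Longrightarrow> cg r x z"
  using cg_add[of r x y y z] by (simp add: rat_cong_def)

lemma cg_Z: "cg r x y \<Longrightarrow> y \<in> Z \<Longrightarrow> x \<in> Z"
proof -
  assume "cg r x y" "y \<in> Z"
  then have "y + P ^ r * ((x - y) / P ^ r) \<in> Z" unfolding rat_cong_def by (intro Z_add Z_mult) simp_all
  then show ?thesis by simp
qed

lemma cg_mult: "cg r x x' \<Longrightarrow> cg r y y' \<Longrightarrow> x \<in> Z \<Longrightarrow> y' \<in> Z \<Longrightarrow> cg r (x * y) (x' * y')"
proof -
  assume *: "cg r x x'" "cg r y y'" "x \<in> Z" "y' \<in> Z"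
  have "(x * y - x' * y') / P ^ r = x * ((y - y') / P ^ r) + (x - x') / P ^ r * y'"
    by (simp add: field_simps)
  also have "\<dots> \<in> Z" using * unfolding rat_cong_def by (intro Z_add Z_mult)
  finally show ?thesis by (simp add: rat_cong_def)
qed

lemma cg_mult_left: "cg r y y' \<Longrightarrow> x \<in> Z \<Longrightarrow> cg r (x * y) (x * y')"
proof -
  assume *: "cg r y y'" "x \<in> Z"
  have "(x * y - x * y') / P ^ r = x * ((y - y') / P ^ r)"
    by (simp add: field_simps)
  also have "\<dots> \<in> Z" using * unfolding rat_cong_def by (intro Z_add Z_mult)
  finally show ?thesis by (simp add: rat_cong_def)
qed

lemma cg_mult_right: "cg r y y' \<Longrightarrow> x \<in> Z \<Longrightarrow> cg r (y * x) (y' * x)"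
  using cg_mult_left[of r y y' x] by (simp add: mult.commute)

lemma cg_power: "cg r x y \<Longrightarrow> y \<in> Z \<Longrightarrow> cg r (x ^ k) (y ^ k)"
  by (induction k) (auto intro!: cg_mult intro: cg_Z)

lemma cg_sum: "(\<And>i. i \<in> A \<Longrightarrow> cg r (f i) (g i)) \<Longrightarrow> cg r (sum f A) (sum g A)"
  by (induction A rule: infinite_finite_induct) (auto intro!: cg_add)

lemma cg_prod: "(\<And>i. i \<in> A \<Longrightarrow> cg r (f i) (g i)) \<Longrightarrow> (\<And>i. i \<in> A \<Longrightarrow> g i \<in> Z) \<Longrightarrow>
    cg r (prod f A) (prod g A)"
proof (induction A rule: infinite_finite_induct)
  case (insert x F)
  then have "f x \<in> Z" using cg_Z by blast
  then show ?case using insert by (auto intro!: cg_mult)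
qed auto

lemma cg_mono: "cg r x y \<Longrightarrow> s \<le> r \<Longrightarrow> cg s x y"
proof -
  assume *: "cg r x y" "s \<le> r"
  have "(x - y) / P ^ s = (x - y) / P ^ r * P ^ (r - s)"
    using *(2) by (simp add: power_diff field_simps)
  also have "\<dots> \<in> Z" using *(1) unfolding rat_cong_def by (intro Z_mult) simp_all
  finally show ?thesis by (simp add: rat_cong_def)
qed

lemma cgI: "x = y + P ^ r * z \<Longrightarrow> z \<in> Z \<Longrightarrow> cg r x y"
  by (simp add: rat_cong_def)

text \<open>This reduces first-order corrections modulo p^2 to congruences modulo p.\<close>

lemma cg_P_iff: "cg (Suc r) (P * x) (P * y) \<longleftrightarrow> cg r x y"
  by (simp add: rat_cong_def flip: right_diff_distrib)

lemma cg_int_iff: "cg r (of_int a) (of_int b) \<longleftrightarrow> [a = b] (mod int p ^ r)"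
proof
  assume "cg r (of_int a) (of_int b)"
  then obtain c d where d: "coprime d (int p)" "of_int (a - b) / P ^ r = of_int c / of_int d"
    unfolding rat_cong_def p_integral_def by auto
  then have "of_int ((a - b) * d) = (of_int (int p ^ r * c) :: rat)"
    using coprime_nz[of d] by (simp add: field_simps)
  then have "(a - b) * d = int p ^ r * c" by (simp only: of_int_eq_iff)
  then have "int p ^ r dvd (a - b) * d" by simp
  moreover have "coprime (int p ^ r) d" using d(1) by (simp add: coprime_commute)
  ultimately show "[a = b] (mod int p ^ r)"
    by (simp add: coprime_dvd_mult_left_iff cong_iff_dvd_diff)
next
  assume "[a = b] (mod int p ^ r)"
  then obtain c where "a - b = int p ^ r * c" by (auto simp: cong_iff_dvd_diff)
  then have "of_int a = of_int b + P ^ r * of_int c"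
    by (metis add.commute diff_add_cancel of_int_add of_int_mult of_int_of_nat_eq of_int_power)
  then show "cg r (of_int a) (of_int b)" by (rule cgI) simp
qed

lemma cg_cancel: "cg r (a * x) (a * y) \<Longrightarrow> inverse a \<in> Z \<Longrightarrow> a \<noteq> 0 \<Longrightarrow> cg r x y"
  using cg_mult_left[of r "a * x" "a * y" "inverse a"] by (simp add: mult.assoc[symmetric])

lemma cg_cancel_nat: "cg r (of_nat k * x) (of_nat k * y) \<Longrightarrow> coprime k p \<Longrightarrow> cg r x y"
proof -
  assume *: "cg r (of_nat k * x) (of_nat k * y)" "coprime k p"
  have "k \<noteq> 0" using *(2) p_gt_3 by (intro notI) simp
  then show ?thesis
    using cg_cancel[OF *(1)] Z_divide[OF Z_numeral(3) *(2)] by (simp add: divide_inverse)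
qed

lemma unit_cong_1: "cg 1 x 1 \<Longrightarrow> inverse x \<in> Z \<and> x \<noteq> 0"
proof -
  assume *: "cg 1 x 1"
  then have "x \<in> Z" by (rule cg_Z) simp
  then obtain a b where b: "coprime b (int p)" "x = of_int a / of_int b"
    unfolding p_integral_def by auto
  have "cg 1 (of_int b * x) (of_int b * 1)" using * by (intro cg_mult_left) auto
  then have "cg 1 (of_int a) (of_int b)" using b coprime_nz by simp
  then have "[a = b] (mod int p)" unfolding cg_int_iff by simp
  then have "coprime a (int p)" using b(1) by (metis cong_imp_coprime cong_sym)
  then show ?thesis
    using b coprime_nz[of a] coprime_nz[of b] by (auto intro!: Z_I[of a _ b])
qed

lemma cg_prod_2:
  assumes "finite A" "\<And>i. i \<in> A \<Longrightarrow> f i \<in> Z"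
  shows "cg 2 (\<Prod>i\<in>A. 1 + P * f i) (1 + P * (\<Sum>i\<in>A. f i))"
  using assms
proof (induction A rule: finite_induct)
  case (insert x F)
  have "cg 2 (\<Prod>i\<in>insert x F. 1 + P * f i) ((1 + P * f x) * (1 + P * (\<Sum>i\<in>F. f i)))"
    using insert by (auto intro!: cg_mult)
  also have "cg 2 \<dots> (1 + P * (\<Sum>i\<in>insert x F. f i))"
    using insert by (intro cgI[where z = "f x * (\<Sum>i\<in>F. f i)"])
      (auto simp: algebra_simps power2_eq_square)
  finally show ?case .
qed auto

text \<open>By Newton's identity the coefficient of p^2 is the second elementary symmetric function
  of the \<open>f i\<close>.\<close>

lemma cg_prod_3:
  assumes "finite A" "\<And>i. i \<in> A \<Longrightarrow> f i \<in> Z"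
  shows "cg 3 (\<Prod>i\<in>A. 1 + P * f i)
    (1 + P * (\<Sum>i\<in>A. f i) + P\<^sup>2 * (((\<Sum>i\<in>A. f i)\<^sup>2 - (\<Sum>i\<in>A. (f i)\<^sup>2)) / 2))"
  using assms
proof (induction A rule: finite_induct)
  case (insert x F)
  define S T where "S = (\<Sum>i\<in>F. f i)" and "T = (\<Sum>i\<in>F. (f i)\<^sup>2)"
  have ST: "S \<in> Z" "T \<in> Z" "f x \<in> Z" using insert by (auto simp: S_def T_def)
  have "cg 3 (\<Prod>i\<in>insert x F. 1 + P * f i) ((1 + P * f x) * (1 + P * S + P\<^sup>2 * ((S\<^sup>2 - T) / 2)))"
    using insert ST by (auto intro!: cg_mult simp: S_def[symmetric] T_def[symmetric])
  also have "cg 3 \<dots> (1 + P * (f x + S) + P\<^sup>2 * (((f x + S)\<^sup>2 - ((f x)\<^sup>2 + T)) / 2))"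
    using ST by (intro cgI[where z = "f x * ((S\<^sup>2 - T) / 2)"])
      (auto simp: field_simps power2_eq_square power3_eq_cube)
  finally show ?case using insert by (simp add: S_def T_def)
qed auto

lemma P_n: "P = 2 * of_nat n + 1" by (subst p_n) simp

lemma cg_inverse_shift:
  assumes "coprime a p" "coprime b p" "(of_nat a :: rat) = - of_nat b + P * c" "c \<in> Z"
  shows "cg 1 (1 / of_nat a) (- (1 / of_nat b))"
proof (rule cgI)
  have "a \<noteq> 0" "b \<noteq> 0" using assms(1,2) p_gt_3 by (auto intro!: Nat.gr0I)
  then show "1 / of_nat a = - (1 / of_nat b) + P ^ 1 * (c / of_nat a / of_nat b)"
    using assms(3) by (simp add: field_simps)
  show "c / of_nat a / of_nat b \<in> Z"
    using assms by (intro Z_divide)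
qed

section \<open>Harmonic numbers modulo p and the Fermat quotient\<close>

lemma harm_full: "cg 1 (gen_harm 1 (p - 1)) 0"
proof -
  have "2 * gen_harm 1 (p - 1) = (\<Sum>j=1..p-1. 1 / of_nat j) + (\<Sum>j=1..p-1. 1 / of_nat (p - j))"
    using sum.atLeastAtMost_rev[of "\<lambda>j. 1 / of_nat j :: rat" 1 "p - 1"] p_gt_3
    by (simp add: gen_harm_def)
  also have "cg 1 \<dots> ((\<Sum>j=1..p-1. 1 / of_nat j) + (\<Sum>j=1..p-1. - (1 / of_nat j)))"
  proof (intro cg_add cg_refl cg_sum)
    fix j assume "j \<in> {1..p-1}"
    then show "cg 1 (1 / of_nat (p - j)) (- (1 / of_nat j))"
      by (intro cg_inverse_shift[where c = 1] coprime_less) (auto simp: of_nat_diff)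
  qed
  also have "\<dots> = 2 * 0" by (simp add: sum_negf)
  finally show ?thesis using cg_cancel_nat[of 1 2 "gen_harm 1 (p - 1)" 0] coprime_23 by simp
qed

lemma harm_reflect:
  assumes "s < p"
  shows "cg 1 (gen_harm 1 (p - 1 - s)) (gen_harm 1 s)"
  using assms
proof (induction s)
  case 0
  then show ?case using harm_full by simp
next
  case (Suc s)
  obtain k where k: "p - 1 - s = Suc k" using Suc.prems by (metis Suc_diff_Suc Suc_lessD diff_Suc_1 diff_Suc_eq_diff_pred)
  have "p - 1 - Suc s = k" using k by simp
  then have "gen_harm 1 (p - 1 - Suc s) = gen_harm 1 (p - 1 - s) - 1 / of_nat (Suc k)"
    using k by simp
  also have "cg 1 \<dots> (gen_harm 1 s - (- (1 / of_nat (Suc s))))"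
    using Suc k by (intro cg_diff cg_inverse_shift[where c = 1] coprime_less)
      (auto simp flip: of_nat_add of_nat_Suc simp: eq_diff_eq)
  finally show ?case by simp
qed

lemma gen_harm_diff:
  assumes "k \<le> m"
  shows "gen_harm r m - gen_harm r (m - k) = (\<Sum>j<k. 1 / (of_nat m - of_nat j) ^ r)"
  using assms
proof (induction k)
  case (Suc k)
  have "gen_harm r (m - k) = gen_harm r (m - Suc k) + 1 / (of_nat m - of_nat k) ^ r"
    using Suc.prems gen_harm_Suc[of r "m - Suc k"] by (simp add: Suc_diff_Suc of_nat_diff)
  then show ?case using Suc by simp
qed simp

lemma coprime_odd: "j < n \<Longrightarrow> coprime (2 * j + 1) p"
  by (rule coprime_less) (use p_n in simp_all)

lemma coprime_le_n: "0 < k \<Longrightarrow> k \<le> n \<Longrightarrow> coprime k p"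
  by (rule coprime_less) (use p_n in simp_all)

text \<open>As 2n is -1 modulo p, 2(n - j) is -(2j + 1).\<close>

lemma inverse_reflect:
  assumes "j < n"
  shows "cg 1 (1 / (of_nat n - of_nat j)) (- (2 / (2 * of_nat j + 1)))"
proof -
  have "cg 1 (2 * (1 / of_nat (2 * (n - j)))) (2 * - (1 / of_nat (2 * j + 1)))"
  proof (intro cg_mult_left cg_inverse_shift[where c = 1])
    show "coprime (2 * (n - j)) p" by (rule coprime_less) (use assms p_n in simp_all)
  qed (use assms coprime_odd in \<open>simp_all add: of_nat_diff P_n\<close>)
  then have "cg 1 (2 * (1 / of_nat (2 * (n - j))) * 1) (- (2 / (2 * of_nat j + 1)))" by simp
  moreover have "2 * (1 / of_nat (2 * (n - j))) = (1 / (of_nat n - of_nat j) :: rat)"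
    using assms by (simp add: of_nat_diff divide_simps)
  ultimately show ?thesis by simp
qed

lemma gen_harm_reflect:
  assumes "k \<le> n"
  shows "cg 1 (gen_harm r n - gen_harm r (n - k)) ((- 1) ^ r * odd_harm r k)"
proof -
  have "cg 1 (\<Sum>j<k. 1 / (of_nat n - of_nat j) ^ r) (\<Sum>j<k. (- (2 / (2 * of_nat j + 1))) ^ r)"
  proof (rule cg_sum)
    fix j assume j: "j \<in> {..<k}"
    have "2 / of_nat (2 * j + 1) \<in> Z" using j assms coprime_odd by (intro Z_divide) auto
    then have "cg 1 ((1 / (of_nat n - of_nat j)) ^ r) ((- (2 / (2 * of_nat j + 1))) ^ r)"
      using inverse_reflect[of j] j assms by (intro cg_power Z_minus) auto
    then show "cg 1 (1 / (of_nat n - of_nat j) ^ r) ((- (2 / (2 * of_nat j + 1))) ^ r)"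
      by (simp add: power_one_over)
  qed
  also have "(\<Sum>j<k. (- (2 / (2 * of_nat j + 1) :: rat)) ^ r) = (- 1) ^ r * odd_harm r k"
    unfolding odd_harm_def sum_distrib_left by (intro sum.cong refl) (metis power_minus)
  finally show ?thesis using gen_harm_diff[OF assms] by simp
qed

text \<open>The odd terms of 2 H_m form the \<open>odd_harm\<close> part; the even terms 2 / (2i) =
  1 / i form the rest.\<close>

lemma odd_harm_half: "odd_harm 1 (m - m div 2) + gen_harm 1 (m div 2) = 2 * gen_harm 1 m"
proof (induction m)
  case (Suc m)
  show ?case
  proof (cases "even m")
    case True
    then obtain k where k: "m = 2 * k" by blast
    then show ?thesis using Suc by (simp add: odd_harm_def add.commute)
  next
    case False
    then obtain k where k: "m = 2 * k + 1" by (blast elim: oddE)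
    have *: "Suc m - Suc m div 2 = m - m div 2" "Suc m div 2 = Suc k" "m div 2 = k" using k by auto
    moreover have "2 * (1 / of_nat (Suc m)) = (1 / of_nat (Suc k) :: rat)"
      using k by (simp add: divide_simps)
    ultimately show ?thesis using Suc unfolding * gen_harm_Suc by (simp add: distrib_left del: of_nat_Suc)
  qed
qed (simp add: odd_harm_def)

text \<open>Reflection turns the upper half of H_n into odd denominators, and the exact splitting
  \<open>odd_harm_half\<close> expresses these through H_n and its lower half; eliminating them
  leaves a relation between the two harmonic numbers.\<close>

lemma harm_half: "cg 1 (2 * gen_harm 1 (n div 2)) (3 * gen_harm 1 n)"
proof -
  let ?H = "gen_harm 1 n" and ?h = "gen_harm 1 (n div 2)"
  have "n - (n - n div 2) = n div 2" by simp
  then have "cg 1 (?H - ?h) (- odd_harm 1 (n - n div 2))"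
    using gen_harm_reflect[of "n - n div 2" 1] by simp
  also have "- odd_harm 1 (n - n div 2) = ?h - 2 * ?H" using odd_harm_half[of n] by simp
  finally have "cg 1 (?h - 2 * ?H + (2 * ?H + ?h)) (?H - ?h + (2 * ?H + ?h))"
    by (intro cg_add cg_refl) (rule cg_sym)
  then show ?thesis by simp
qed

text \<open>The odd indices are listed as 2m + 1 - 2i because for m = n this is p - 2i, ready for
  reflection.\<close>

lemma sum_even_odd: "(\<Sum>j=1..2*m. f j) = (\<Sum>i=1..m. f (2 * i)) + (\<Sum>i=1..m. f (2 * m + 1 - 2 * i))"
  for f :: "nat \<Rightarrow> rat"
proof -
  have "(\<Sum>i=1..m. f (2 * m + 1 - 2 * i)) = (\<Sum>i=1..m. f (2 * i - 1))"
    by (subst sum.atLeastAtMost_rev) (auto intro!: sum.cong arg_cong[of _ _ f])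
  moreover have "(\<Sum>j=1..2*m. f j) = (\<Sum>i=1..m. f (2 * i)) + (\<Sum>i=1..m. f (2 * i - 1))"
    by (induction m) simp_all
  ultimately show ?thesis by simp
qed

text \<open>The even and the odd terms each contribute a quarter of the half sum E, while the
  reflection j -> p - j gives 2E for the full sum; hence 3E/2 vanishes modulo p.\<close>

lemma gen_harm_2_half: "cg 1 (gen_harm 2 n) 0"
proof -
  let ?E = "gen_harm 2 n"
  define f :: "nat \<Rightarrow> rat" where "f j = 1 / of_nat j ^ 2" for j
  have f_refl: "cg 1 (f (p - j)) (f j)" if "j \<in> {1..p-1}" for j
  proof -
    have "1 / of_nat j \<in> Z" using that by (intro Z_divide coprime_less) auto
    moreover have "cg 1 (1 / of_nat (p - j)) (- (1 / of_nat j))"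
      using that by (intro cg_inverse_shift[where c = 1] coprime_less) (auto simp: of_nat_diff)
    ultimately have "cg 1 ((1 / of_nat (p - j))\<^sup>2) ((- (1 / of_nat j))\<^sup>2)" by (intro cg_power) auto
    then show ?thesis by (simp add: f_def power_one_over)
  qed
  have E: "?E = (\<Sum>j=1..n. f j)" by (simp add: gen_harm_def f_def)
  have E4: "(\<Sum>i=1..n. f (2 * i)) = ?E / 4"
    unfolding E sum_divide_distrib
    by (intro sum.cong refl) (simp add: f_def power_mult_distrib mult.commute)
  have "(\<Sum>j=1..2*n. f j) = (\<Sum>j=1..n. f j) + (\<Sum>j=1..n. f (p - j))"
  proof -
    have "(\<Sum>j=1..2*n. f j) = (\<Sum>j=1..n. f j) + (\<Sum>j=n+1..2*n. f j)"
      using sum.ub_add_nat[of 1 n f n] by (simp add: mult_2)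
    also have "(\<Sum>j=n+1..2*n. f j) = (\<Sum>j=1..n. f (p - j))"
      by (rule sum.reindex_bij_witness[of _ "\<lambda>j. p - j" "\<lambda>j. p - j"]) (auto simp: p_n)
    finally show ?thesis .
  qed
  also have "cg 1 \<dots> (?E + ?E)"
    unfolding E by (intro cg_add cg_sum cg_refl f_refl) (auto simp: p_n)
  finally have 1: "cg 1 (\<Sum>j=1..2*n. f j) (?E + ?E)" .
  have "(\<Sum>j=1..2*n. f j) = (\<Sum>i=1..n. f (2 * i)) + (\<Sum>i=1..n. f (p - 2 * i))"
    unfolding sum_even_odd[of f n] by (simp add: p_n)
  also have "cg 1 \<dots> (?E / 4 + ?E / 4)"
    unfolding E4[symmetric] by (intro cg_add cg_sum cg_refl f_refl) (auto simp: p_n)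
  finally have "cg 1 (?E + ?E) (?E / 4 + ?E / 4)" using 1 cg_sym cg_trans by blast
  then have "cg 1 (2 * (?E + ?E - (?E / 4 + ?E / 4))) (2 * 0)"
    by (intro cg_mult_left) (auto simp: rat_cong_def)
  then show ?thesis using cg_cancel_nat[of 1 3 ?E 0] coprime_23 by simp
qed

section \<open>The power 2^(p-1) and the Fermat quotient\<close>

lemma fact_double_odd: "(fact (2 * m) :: rat) = 2 ^ m * fact m * (\<Prod>j<m. 2 * of_nat j + 1)"
  by (induction m) (simp_all add: algebra_simps)

lemma fact_prod_rev:
  assumes "m < p"
  shows "(fact (p - 1) :: rat) = fact (p - 1 - m) * (\<Prod>k=1..m. P - of_nat k)"
  using assms
proof (induction m)
  case (Suc m)
  have "p - 1 - m = Suc (p - 1 - Suc m)" using Suc.prems by simp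
  then have "(fact (p - 1 - m) :: rat) = of_nat (p - Suc m) * fact (p - 1 - Suc m)"
    by (metis Suc_diff_Suc diff_Suc_1 diff_Suc_eq_diff_pred fact_Suc of_nat_fact Suc.prems Suc_lessD diff_commute)
  then show ?case using Suc by (simp add: of_nat_diff)
qed simp

text \<open>Two evaluations of (2n)! / n!: as the product of the p - k, and as 2^n times the product
  of the odd numbers below p, which are the p - 2k. Taking out the factors -k and -2k leaves factors
  near 1.\<close>

lemma power_2_prod:
  "2 ^ (p - 1) * (\<Prod>k=1..n. 1 + P * (- (1 / (2 * of_nat k)))) = (\<Prod>k=1..n. 1 + P * (- (1 / of_nat k)))"
proof -
  have nz: "(\<Prod>k=1..n. - of_nat k :: rat) \<noteq> 0" by auto
  have A: "(\<Prod>k=1..n. - of_nat k) * (\<Prod>k=1..n. 1 + P * (- (1 / of_nat k))) = (\<Prod>k=1..n. P - of_nat k)"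
    unfolding prod.distrib[symmetric] by (intro prod.cong refl) (simp add: field_simps)
  have "(\<Prod>k=1..n. - (2 * of_nat k)) * (\<Prod>k=1..n. 1 + P * (- (1 / (2 * of_nat k)))) = (\<Prod>k=1..n. P - 2 * of_nat k)"
    unfolding prod.distrib[symmetric] by (intro prod.cong refl) (simp add: field_simps)
  also have "\<dots> = (\<Prod>j<n. 2 * of_nat j + 1)"
    by (rule prod.reindex_bij_witness[of _ "\<lambda>j. n - j" "\<lambda>j. n - j"]) (auto simp: of_nat_diff P_n)
  also have "(\<Prod>k=1..n. - (2 * of_nat k) :: rat) = 2 ^ n * (\<Prod>k=1..n. - of_nat k)"
    using prod.distrib[of "\<lambda>_. 2" "\<lambda>k. - of_nat k :: rat" "{1..n}"] by simp
  finally have B: "2 ^ n * (\<Prod>k=1..n. - of_nat k) * (\<Prod>k=1..n. 1 + P * (- (1 / (2 * of_nat k)))) =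
      (\<Prod>j<n. 2 * of_nat j + 1)" .
  have "fact n * (\<Prod>k=1..n. P - of_nat k) = fact n * (2 ^ n * (\<Prod>j<n. 2 * of_nat j + 1 :: rat))"
  proof -
    have "p - 1 = 2 * n" "2 * n - n = n" "n < p" using p_n by simp_all
    then show ?thesis using fact_prod_rev[of n] fact_double_odd[of n] by (simp add: mult_ac)
  qed
  then have C: "(\<Prod>k=1..n. P - of_nat k) = 2 ^ n * (\<Prod>j<n. 2 * of_nat j + 1 :: rat)" by simp
  have "(2::rat) ^ (p - 1) = 2 ^ n * 2 ^ n" using p_n by (simp add: mult_2 power_add)
  then have "(\<Prod>k=1..n. - of_nat k) * (2 ^ (p - 1) * (\<Prod>k=1..n. 1 + P * (- (1 / (2 * of_nat k))))) =
      (\<Prod>k=1..n. - of_nat k) * (\<Prod>k=1..n. 1 + P * (- (1 / of_nat k)))"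
    unfolding A C B[symmetric] by (simp add: mult_ac)
  then show ?thesis using nz by (simp only: mult_cancel_left) simp
qed

abbreviation H :: rat where "H \<equiv> gen_harm 1 n"
abbreviation q :: rat where "q \<equiv> fermat_quotient p 2"

lemma H_Z [simp]: "H \<in> Z"
  by (rule Z_gen_harm) (use p_n in simp)

lemma power_2_eq: "2 ^ (p - 1) = 1 + P * q"
  by (simp add: fermat_quotient_def)

text \<open>With X the second-order expansion of the left product in \<open>power_2_prod\<close>, the expansion of the
  right product is X * X, because the sum of the inverse squares vanishes modulo p.\<close>

lemma power_2_cong: "cg 3 (2 ^ (p - 1)) (1 - P * (H / 2) + P\<^sup>2 * (H\<^sup>2 / 8))"
proof -
  define X where "X = 1 - P * (H / 2) + P\<^sup>2 * (H\<^sup>2 / 8)"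
  define E where "E = gen_harm 2 n"
  define A B where "A = (\<Prod>k=1..n. 1 + P * (- (1 / (2 * of_nat k))))"
    and "B = (\<Prod>k=1..n. 1 + P * (- (1 / of_nat k)))"
  have XZ: "X \<in> Z" unfolding X_def by (intro Z_add Z_diff Z_mult Z_power Z_div_numeral) auto
  have inv: "1 / of_nat k \<in> Z" if "k \<in> {1..n}" for k
    using that by (intro Z_divide coprime_le_n) auto
  have E0: "E / P \<in> Z" using gen_harm_2_half by (simp add: rat_cong_def E_def)
  have s: "(\<Sum>k=1..n. - (1 / (2 * of_nat k))) = - H / 2" "(\<Sum>k=1..n. (- (1 / (2 * of_nat k)))\<^sup>2) = E / 4"
    "(\<Sum>k=1..n. - (1 / of_nat k)) = - H" "(\<Sum>k=1..n. (- (1 / of_nat k))\<^sup>2) = E"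
    by (simp_all add: gen_harm_def E_def sum_negf sum_divide_distrib power_divide power_mult_distrib mult.commute)
  have inv2: "1 / (2 * of_nat k) \<in> Z" if "k \<in> {1..n}" for k
    using Z_div_numeral(1)[OF inv[OF that]] by (simp add: mult.commute)
  have "cg 3 A (1 + P * (- H / 2) + P\<^sup>2 * (((- H / 2)\<^sup>2 - E / 4) / 2))"
    using cg_prod_3[of "{1..n}" "\<lambda>k. - (1 / (2 * of_nat k))"] inv2 unfolding s A_def by auto
  also have "cg 3 \<dots> X"
  proof (rule cgI)
    show "1 + P * (- H / 2) + P\<^sup>2 * (((- H / 2)\<^sup>2 - E / 4) / 2) = X + P ^ 3 * - (E / P / 8)"
      by (simp add: X_def field_simps power2_eq_square power3_eq_cube)
    show "- (E / P / 8) \<in> Z" by (intro Z_minus Z_div_numeral E0)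
  qed
  finally have A: "cg 3 A X" .
  have "cg 3 B (1 + P * (- H) + P\<^sup>2 * (((- H)\<^sup>2 - E) / 2))"
    using cg_prod_3[of "{1..n}" "\<lambda>k. - (1 / of_nat k)"] inv unfolding s B_def by auto
  also have "cg 3 \<dots> (X * X)"
  proof (intro cgI[where z = "- (E / P) / 2 + H\<^sup>2 * H / 8 - P * (H\<^sup>2 / 8)\<^sup>2"])
    show "1 + P * - H + P\<^sup>2 * (((- H)\<^sup>2 - E) / 2) =
        X * X + P ^ 3 * (- (E / P) / 2 + H\<^sup>2 * H / 8 - P * (H\<^sup>2 / 8)\<^sup>2)"
      by (simp add: X_def field_simps power2_eq_square power3_eq_cube)
    show "- (E / P) / 2 + H\<^sup>2 * H / 8 - P * (H\<^sup>2 / 8)\<^sup>2 \<in> Z"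
      using E0 by (intro Z_add Z_diff Z_mult Z_power Z_div_numeral Z_minus) auto
  qed
  finally have B: "cg 3 B (X * X)" .
  have "cg 3 (X * 2 ^ (p - 1)) (2 ^ (p - 1) * A)"
    unfolding mult.commute[of X] by (intro cg_mult_left cg_sym[OF A] Z_power) auto
  also have "2 ^ (p - 1) * A = B" using power_2_prod by (simp add: A_def B_def)
  also note B
  finally have "cg 3 (X * 2 ^ (p - 1)) (X * X)" .
  moreover have "cg 1 X 1"
  proof (rule cgI)
    show "X = 1 + P ^ 1 * (- (H / 2) + P * (H\<^sup>2 / 8))"
      by (simp add: X_def algebra_simps power2_eq_square)
    show "- (H / 2) + P * (H\<^sup>2 / 8) \<in> Z" by (intro Z_add Z_minus Z_mult Z_power Z_div_numeral) auto
  qed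
  ultimately show ?thesis using cg_cancel unit_cong_1 unfolding X_def by blast
qed

text \<open>Passing to the quotient divides by p; hence the need for 2^(p-1) modulo p^3.\<close>

lemma quotient_cong: "cg 2 q (- (H / 2) + P * (H\<^sup>2 / 8))"
proof -
  have "cg 3 (1 + P * q - 1) (1 - P * (H / 2) + P\<^sup>2 * (H\<^sup>2 / 8) - 1)"
    using power_2_cong unfolding power_2_eq by (intro cg_diff) auto
  then have "cg (Suc 2) (P * q) (P * (- (H / 2) + P * (H\<^sup>2 / 8)))"
    by (simp add: algebra_simps power2_eq_square numeral_3_eq_3 numeral_2_eq_2)
  then show ?thesis unfolding cg_P_iff .
qed

lemma q_Z [simp]: "q \<in> Z"
  by (rule cg_Z[OF quotient_cong]) simp

lemma H_cong_1: "cg 1 H (- 2 * q)"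
proof -
  have "cg 1 q (- (H / 2) + P * (H\<^sup>2 / 8))" using quotient_cong cg_mono by fastforce
  also have "cg 1 \<dots> (- (H / 2))" by (rule cgI[where z = "H\<^sup>2 / 8"]) auto
  finally have "cg 1 (- 2 * q) (- 2 * (- (H / 2)))" by (rule cg_mult_left) auto
  then show ?thesis using cg_sym by simp
qed

text \<open>Inverts the quadratic relation in \<open>quotient_cong\<close>: in its term of order p,
  H^2 is needed only modulo p, where H is -2q.\<close>

lemma H_cong_2: "cg 2 H (- 2 * q + P * q\<^sup>2)"
proof -
  have "cg 1 (H\<^sup>2) ((- 2 * q)\<^sup>2)" by (intro cg_power H_cong_1) auto
  then have "cg (Suc 1) (P * H\<^sup>2) (P * (- 2 * q)\<^sup>2)" unfolding cg_P_iff .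
  then have 1: "cg 2 (P * H\<^sup>2 / 4) (P * (- 2 * q)\<^sup>2 / 4)"
    using cg_mult_left[of 2 "P * H\<^sup>2" "P * (- 2 * q)\<^sup>2" "1 / 4"] by (auto simp: numeral_2_eq_2)
  have "cg 2 (- 2 * q) (- 2 * (- (H / 2) + P * (H\<^sup>2 / 8)))" by (intro cg_mult_left quotient_cong) auto
  then have "cg 2 (- 2 * q + P * (- 2 * q)\<^sup>2 / 4) (- 2 * (- (H / 2) + P * (H\<^sup>2 / 8)) + P * H\<^sup>2 / 4)"
    by (intro cg_add cg_sym[OF 1])
  then have "cg 2 (- 2 * q + P * q\<^sup>2) H"
    by (simp add: power_mult_distrib)
  then show ?thesis by (rule cg_sym)
qed

end

section \<open>The binomial sums modulo p^2\<close>

lemma central_binomial_fact: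
  "of_nat ((2 * k) choose k) = (fact (2 * k) / (fact k)\<^sup>2 :: rat)"
  using binomial_fact[of k "2 * k", where ?'a = rat] by (simp add: power2_eq_square)

lemma central_binomial_prod:
  "of_nat ((2 * k) choose k) / 4 ^ k = (\<Prod>j<k. (2 * of_nat j + 1) / (2 * of_nat (Suc j)) :: rat)"
proof (induction k)
  case (Suc k)
  have "of_nat ((2 * Suc k) choose Suc k) / 4 ^ Suc k =
      (of_nat ((2 * k) choose k) / 4 ^ k :: rat) * ((2 * of_nat k + 1) / (2 * of_nat (Suc k)))"
    unfolding central_binomial_fact by (simp add: divide_simps power2_eq_square) (simp add: algebra_simps)
  then show ?case using Suc by simp
qed simp

lemma legendre_sum_even_const:
  "(\<Prod>j=1..m. (2 * of_nat j - 1) / (2 * of_nat j) :: rat)\<^sup>2 = (fact (2 * m))\<^sup>2 / (16 ^ m * fact m ^ 4)"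
proof -
  have "(\<Prod>j=1..m. (2 * of_nat j - 1) / (2 * of_nat j) :: rat) = fact (2 * m) / (4 ^ m * (fact m)\<^sup>2)"
  proof (induction m)
    case (Suc m)
    have "(\<Prod>j=1..Suc m. (2 * of_nat j - 1) / (2 * of_nat j) :: rat) =
        fact (2 * m) / (4 ^ m * (fact m)\<^sup>2) * ((2 * of_nat m + 1) / (2 * (of_nat m + 1)))"
      unfolding Suc.IH[symmetric] by (simp add: add.commute)
    also have "\<dots> = fact (2 * Suc m) / (4 ^ Suc m * (fact (Suc m))\<^sup>2)"
    proof -
      have "(of_nat m + 1 :: rat) \<noteq> 0" using of_nat_0_le_iff[of m, where ?'a = rat] by linarith
      then show ?thesis by (simp add: divide_simps power2_eq_square) (simp add: algebra_simps)
    qed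
    finally show ?case .
  qed simp
  moreover have "(16::rat) ^ m = (4 ^ m)\<^sup>2" using power_mult_distrib[of "4::rat" 4 m] by (simp add: power2_eq_square)
  ultimately show ?thesis
    by (simp add: power_divide power_mult_distrib flip: power_mult)
qed

lemma legendre_sum_odd_const:
  "(\<Prod>j=1..m. 2 * of_nat j / (2 * of_nat j + 1) :: rat)\<^sup>2 = 16 ^ m * fact m ^ 4 / (fact (Suc (2 * m)))\<^sup>2"
proof -
  have "(\<Prod>j=1..m. 2 * of_nat j / (2 * of_nat j + 1) :: rat) = 4 ^ m * (fact m)\<^sup>2 / fact (Suc (2 * m))"
  proof (induction m)
    case (Suc m)
    have "(2 * of_nat m + 3 :: rat) \<noteq> 0" "(2 * of_nat m + 2 :: rat) \<noteq> 0"
      using of_nat_0_le_iff[of m, where ?'a = rat] by linarith+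
    then have "4 ^ m * (fact m)\<^sup>2 / fact (Suc (2 * m)) * ((2 * of_nat m + 2) / (2 * of_nat m + 3) :: rat) =
        4 ^ Suc m * (fact (Suc m))\<^sup>2 / fact (Suc (2 * Suc m))"
      by (simp add: divide_simps power2_eq_square) (simp add: algebra_simps)
    moreover have "(\<Prod>j=1..Suc m. 2 * of_nat j / (2 * of_nat j + 1) :: rat) =
        4 ^ m * (fact m)\<^sup>2 / fact (Suc (2 * m)) * ((2 * of_nat m + 2) / (2 * of_nat m + 3))"
      unfolding Suc.IH[symmetric] by (simp add: add.commute)
    ultimately show ?case by simp
  qed (simp add: One_nat_def)
  moreover have "(16::rat) ^ m = (4 ^ m)\<^sup>2" using power_mult_distrib[of "4::rat" 4 m] by (simp add: power2_eq_square)
  ultimately show ?thesis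
    by (simp add: power_divide power_mult_distrib flip: power_mult)
qed

context prime_gt_3
begin

text \<open>Only 2 and j + 1 are inverted. The factor 2j + 1, equal to p at j = n, stays in the
  numerator, so the weights can be compared for all k < p, also beyond n, where the Legendre
  coefficient is exactly 0.\<close>

lemma coeff_factor_cong:
  assumes "Suc j < p"
  defines "g \<equiv> - ((of_nat n - of_nat j) * (of_nat n + 1 + of_nat j) * (2 * of_nat j + 1)) / (2 * (of_nat j + 1) ^ 3)"
  shows "g \<in> Z" and "cg 2 (((2 * of_nat j + 1) / (2 * of_nat (Suc j))) ^ 3) g"
proof -
  define a where "a = 1 / (of_nat (Suc j) :: rat)"
  define o1 :: rat where "o1 = of_nat (2 * j + 1)"
  have nz: "(of_nat j + 1 :: rat) \<noteq> 0" using of_nat_0_le_iff[of j, where ?'a = rat] by linarith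
  have aZ: "a \<in> Z" unfolding a_def using assms(1) by (intro Z_divide coprime_less) auto
  have oZ: "o1 \<in> Z" unfolding o1_def by simp
  have f: "(2 * of_nat j + 1) / (2 * of_nat (Suc j)) = o1 * a / 2"
    by (simp add: a_def o1_def)
  have "g = - (((P - 1) / 2 - of_nat j) * ((P - 1) / 2 + 1 + of_nat j) * o1) * a ^ 3 / 2"
    by (simp add: g_def a_def o1_def P_n power_divide add.commute)
  also have "((P - 1) / 2 - of_nat j) * ((P - 1) / 2 + 1 + of_nat j) = (P\<^sup>2 - o1\<^sup>2) / 4"
    by (simp add: o1_def field_simps power2_eq_square)
  finally have g: "g = (o1 * a / 2) ^ 3 + P ^ 2 * (- (o1 * a ^ 3) / 8)"
    by (simp add: power2_eq_square power3_eq_cube field_simps)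
  show "cg 2 (((2 * of_nat j + 1) / (2 * of_nat (Suc j))) ^ 3) g"
    unfolding f by (rule cg_sym, rule cgI[OF g]) (intro Z_div_numeral Z_minus Z_mult Z_power oZ aZ)
  show "g \<in> Z" unfolding g
    by (intro Z_add Z_div_numeral Z_minus Z_mult Z_power oZ aZ Z_of_nat)
qed

lemma legendre_coeff_Z: "k < p \<Longrightarrow> legendre_coeff (of_nat n) k \<in> Z"
  unfolding legendre_coeff_def by (intro Z_prod coeff_factor_cong) auto

lemma coeff_cong:
  assumes "k < p"
  shows "cg 2 (of_nat ((2 * k) choose k) ^ 3 / 64 ^ k) (legendre_coeff (of_nat n) k)"
proof -
  have "of_nat ((2 * k) choose k) ^ 3 / 64 ^ k = (of_nat ((2 * k) choose k) / 4 ^ k :: rat) ^ 3"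
    using power_mult[of "4::rat" k 3] power_mult[of "4::rat" 3 k] by (simp add: power_divide mult.commute)
  also have "\<dots> = (\<Prod>j<k. ((2 * of_nat j + 1) / (2 * of_nat (Suc j))) ^ 3)"
    unfolding central_binomial_prod by (simp add: prod_power_distrib)
  also have "cg 2 \<dots> (legendre_coeff (of_nat n) k)"
    unfolding legendre_coeff_def using assms by (intro cg_prod coeff_factor_cong) auto
  finally show ?thesis .
qed

lemma binomial_sum_cong:
  "cg 2 (\<Sum>k=1..p-1. of_nat ((2 * k) choose k) ^ 3 * (gen_harm r k / 64 ^ k)) (legendre_sum n (gen_harm r))"
proof -
  have "(\<Sum>k=1..p-1. of_nat ((2 * k) choose k) ^ 3 * (gen_harm r k / 64 ^ k)) =
      (\<Sum>k\<le>p-1. of_nat ((2 * k) choose k) ^ 3 / 64 ^ k * gen_harm r k)"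
    by (rule sum.mono_neutral_cong_left) (auto simp: not_le)
  also have "cg 2 \<dots> (\<Sum>k\<le>p-1. legendre_coeff (of_nat n) k * gen_harm r k)"
  proof (intro cg_sum cg_mult_right coeff_cong Z_gen_harm)
    fix k assume "k \<in> {..p - 1}"
    then show "k < p" "k < p" using p_gt_3 by auto
  qed
  also have "\<dots> = legendre_sum n (gen_harm r)"
    by (rule legendre_sum_cutoff) (use p_n in simp)
  finally show ?thesis .
qed

section \<open>Odd n: reflection and the comparison of harmonic weights\<close>

text \<open>Modulo p both binom(n+k,k) and binom(2k,k) / 4^k reduce to (-1)^k binom(n,k). The cube
  shows a symmetry under k -> n - k, up to sign, that the exact coefficients lack.\<close>

lemma legendre_coeff_binomial:
  assumes "k \<le> n"
  shows "cg 1 (legendre_coeff (of_nat n) k) ((- 1) ^ k * of_nat (n choose k) ^ 3)"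
  using assms
proof (induction k)
  case (Suc k)
  define x where "x = (of_nat (n - k) :: rat)"
  define a where "a = 1 / (of_nat (Suc k) :: rat)"
  have x: "of_nat n = x + of_nat k" using Suc.prems by (simp add: x_def of_nat_diff)
  have aZ: "a \<in> Z" unfolding a_def using Suc.prems by (intro Z_divide coprime_le_n) auto
  have xZ: "x \<in> Z" by (simp add: x_def)
  have "Suc k * (n choose Suc k) = (n - k) * (n choose k)"
    by (metis binomial_absorb_comp binomial_absorption)
  then have "of_nat (Suc k) * of_nat (n choose Suc k) = x * (of_nat (n choose k) :: rat)"
    by (metis of_nat_mult x_def)
  then have b: "of_nat (n choose Suc k) = x * a * of_nat (n choose k)"
    by (simp add: a_def field_simps del: of_nat_Suc)
  have g: "- ((of_nat n - of_nat k) * (of_nat n + 1 + of_nat k) * (2 * of_nat k + 1)) / (2 * (of_nat k + 1) ^ 3)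
      = - ((x * a) ^ 3) + P ^ 1 * (- (x * a ^ 3 * (P - 3 * x)) / 2)"
  proof -
    \<comment> \<open>In terms of x = n - k the three factors are -x, -2x and x modulo p.\<close>
    have e: "of_nat n + 1 + of_nat k = P - x" "2 * of_nat k + 1 = P - 2 * x" "of_nat n - of_nat k = x"
      by (simp_all add: P_n x)
    have "- ((of_nat n - of_nat k) * (of_nat n + 1 + of_nat k) * (2 * of_nat k + 1)) / (2 * (of_nat k + 1) ^ 3)
       = - (x * (P - x) * (P - 2 * x)) / 2 * a ^ 3"
      unfolding e by (simp add: a_def power_divide add.commute)
    also have "\<dots> = - ((x * a) ^ 3) + P ^ 1 * (- (x * a ^ 3 * (P - 3 * x)) / 2)"
      by (simp add: field_simps power3_eq_cube)
    finally show ?thesis .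
  qed
  have "cg 1 (legendre_coeff (of_nat n) (Suc k)) ((- 1) ^ k * of_nat (n choose k) ^ 3 * - ((x * a) ^ 3))"
    unfolding legendre_coeff_Suc
  proof (intro cg_mult Suc.IH)
    show "cg 1 (- ((of_nat n - of_nat k) * (of_nat n + 1 + of_nat k) * (2 * of_nat k + 1)) / (2 * (of_nat k + 1) ^ 3))
       (- ((x * a) ^ 3))"
      by (rule cgI[OF g]) (intro Z_div_numeral Z_minus Z_mult Z_diff Z_power xZ aZ Z_of_nat Z_numeral)
    show "legendre_coeff (of_nat n) k \<in> Z" using Suc.prems p_n by (intro legendre_coeff_Z) simp
  qed (use Suc.prems xZ aZ in auto)
  then show ?case unfolding b by (simp add: power_mult_distrib mult_ac)
qed simp

text \<open>Under k -> n - k the coefficient changes sign because n is odd, and the weight because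
  \<open>gen_harm 2 n\<close> vanishes modulo p; the two signs cancel.\<close>

lemma odd_harm_2_sum:
  assumes "odd n"
  shows "cg 1 (legendre_sum n (odd_harm 2)) (legendre_sum n (gen_harm 2))"
proof -
  let ?t = "legendre_coeff (of_nat n)"
  have tZ: "?t k \<in> Z" if "k \<le> n" for k using that p_n by (intro legendre_coeff_Z) simp
  have hZ: "gen_harm 2 k \<in> Z" if "k \<le> n" for k using that p_n by (intro Z_gen_harm) simp
  have refl: "cg 1 (?t k) (- ?t (n - k))" if "k \<le> n" for k
  proof -
    have "(- 1 :: rat) ^ k = - ((- 1) ^ (n - k))"
    proof (cases "even k")
      case True
      then have "odd (n - k)" using assms that by simp
      with True show ?thesis by simp
    next
      case False
      then have "even (n - k)" using assms that by simp
      with False show ?thesis by simp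
    qed
    then have "(- 1) ^ k * of_nat (n choose k) ^ 3 = - ((- 1) ^ (n - k) * of_nat (n choose (n - k)) ^ 3 :: rat)"
      using binomial_symmetric[OF that] by simp
    moreover have "cg 1 (- ((- 1) ^ (n - k) * of_nat (n choose (n - k)) ^ 3)) (- ?t (n - k))"
      by (intro cg_minus cg_sym[OF legendre_coeff_binomial]) simp
    ultimately show ?thesis using cg_trans[OF legendre_coeff_binomial[OF that]] by simp
  qed
  have harm: "cg 1 (odd_harm 2 k) (- gen_harm 2 (n - k))" if "k \<le> n" for k
  proof -
    have "cg 1 (odd_harm 2 k) (gen_harm 2 n - gen_harm 2 (n - k))"
      using cg_sym[OF gen_harm_reflect[OF that, of 2]] by simp
    also have "cg 1 \<dots> (0 - gen_harm 2 (n - k))" by (intro cg_diff gen_harm_2_half cg_refl)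
    finally show ?thesis by simp
  qed
  have "cg 1 (legendre_sum n (odd_harm 2)) (\<Sum>k\<le>n. (- ?t (n - k)) * (- gen_harm 2 (n - k)))"
    unfolding legendre_sum_def by (intro cg_sum cg_mult refl harm) (auto intro!: tZ hZ Z_minus)
  also have "\<dots> = (\<Sum>k\<le>n. ?t k * gen_harm 2 k)"
    by (rule sum.reindex_bij_witness[of _ "\<lambda>k. n - k" "\<lambda>k. n - k"]) auto
  finally show ?thesis by (simp only: legendre_sum_def)
qed

lemma shifted_harm_cong:
  assumes "k \<le> n"
  shows "cg 2 (gen_harm 1 (n + k) - gen_harm 1 n) (odd_harm 1 k - P / 2 * odd_harm 2 k)"
proof -
  have "gen_harm 1 (n + k) - gen_harm 1 n = (\<Sum>j<k. 1 / of_nat (n + 1 + j))"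
    by (induction k) (simp_all add: algebra_simps)
  also have "cg 2 \<dots> (\<Sum>j<k. 2 / (2 * of_nat j + 1) - P / 2 * (2 / (2 * of_nat j + 1))\<^sup>2)"
  proof (rule cg_sum)
    fix j assume j: "j \<in> {..<k}"
    define o1 :: rat where "o1 = of_nat (2 * j + 1)"
    have "1 / o1 \<in> Z" unfolding o1_def using j assms by (intro Z_divide coprime_odd) auto
    moreover have "1 / of_nat (n + 1 + j) \<in> Z"
      by (intro Z_divide Z_numeral coprime_less) (use j assms p_n in auto)
    ultimately have z: "1 / of_nat (n + 1 + j) * (1 / o1)\<^sup>2 \<in> Z" by (intro Z_mult Z_power)
    have pos: "o1 > 0" "o1 + P > 0" using p_pos by (simp_all add: o1_def add_pos_pos del: p_pos)
    have e: "2 / (o1 + P) = 1 / of_nat (n + 1 + j)" unfolding o1_def P_n by (simp add: divide_simps)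
    \<comment> \<open>As 1 / (n + 1 + j) = 2 / (p + (2j + 1)), this is the geometric expansion in p
      with its exact remainder. The cofactor is p-integral because n + 1 + j and 2j + 1 lie strictly
      between 0 and p.\<close>
    have "2 / (o1 + P) = 2 / o1 - P / 2 * (2 / o1)\<^sup>2 + P ^ 2 * (2 / (o1 + P) * (1 / o1)\<^sup>2)"
    proof -
      have "2 / w = 2 / o1 - (w - o1) / 2 * (2 / o1)\<^sup>2 + (w - o1) ^ 2 * (2 / w * (1 / o1)\<^sup>2)"
        if "w > 0" for w
        using pos(1) that by (simp add: field_simps power2_eq_square)
      from this[OF pos(2)] show ?thesis by (simp only: add_diff_cancel_left')
    qed
    from cgI[OF this[unfolded e] z] show "cg 2 (1 / of_nat (n + 1 + j)) (2 / (2 * of_nat j + 1) - P / 2 * (2 / (2 * of_nat j + 1))\<^sup>2)"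
      by (simp add: o1_def)
  qed
  also have "(\<Sum>j<k. 2 / (2 * of_nat j + 1) - P / 2 * (2 / (2 * of_nat j + 1))\<^sup>2) = odd_harm 1 k - P / 2 * odd_harm 2 k"
    by (simp add: odd_harm_def sum_subtractf sum_distrib_left)
  finally show ?thesis .
qed

lemma harm_sum_odd:
  assumes "odd n"
  shows "cg 2 (legendre_sum n (gen_harm 1)) (P / 3 * legendre_sum n (gen_harm 2))"
proof -
  let ?t = "legendre_coeff (of_nat n)"
  let ?U = "legendre_sum n (gen_harm 1)" and ?V = "legendre_sum n (gen_harm 2)" and ?Y = "legendre_sum n (odd_harm 2)"
  obtain m where m: "n = Suc (2 * m)" using assms by (auto elim: oddE)
  have tZ: "?t k \<in> Z" if "k \<le> n" for k using that p_n by (intro legendre_coeff_Z) simp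
  have S: "(\<Sum>k\<le>n. ?t k) = 0" using legendre_sum_even(2)[of m] by (simp add: legendre_sum_def m)
  \<comment> \<open>The coefficients sum to 0, so the constant H_n may be subtracted; what remains
    expands into odd harmonic numbers.\<close>
  have "?U / 2 = (\<Sum>k\<le>n. ?t k * (gen_harm 1 (n + k) - gen_harm 1 n))"
    using legendre_sum_odd(3)[of m] S
    by (simp add: legendre_sum_def right_diff_distrib sum_subtractf flip: sum_distrib_right m)
  also have "cg 2 \<dots> (\<Sum>k\<le>n. ?t k * (odd_harm 1 k - P / 2 * odd_harm 2 k))"
    by (intro cg_sum cg_mult_left shifted_harm_cong tZ) auto
  also have "\<dots> = legendre_sum n (odd_harm 1) - P / 2 * ?Y"
    by (simp add: legendre_sum_def right_diff_distrib sum_subtractf sum_distrib_left mult_ac)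
  also have "legendre_sum n (odd_harm 1) = 2 * ?U" using legendre_sum_odd(2)[of m] by (simp add: m)
  finally have 1: "cg 2 (?U / 2) (2 * ?U - P / 2 * ?Y)" .
  have "cg (Suc 1) (P * ?Y) (P * ?V)" unfolding cg_P_iff by (rule odd_harm_2_sum[OF assms])
  then have 2: "cg 2 (P * ?Y) (P * ?V)" by (simp add: numeral_2_eq_2 One_nat_def)
  \<comment> \<open>Here 3U/2 meets pY/2, so division by 3/2 yields the factor p/3.\<close>
  have "cg 2 (2 * ?U - ?U / 2) (2 * ?U - (2 * ?U - P / 2 * ?Y))" by (intro cg_diff cg_refl 1)
  then have "cg 2 ((2 / 3) * (2 * ?U - ?U / 2)) ((2 / 3) * (2 * ?U - (2 * ?U - P / 2 * ?Y)))"
    by (rule cg_mult_left) (intro Z_div_numeral Z_numeral)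
  then have "cg 2 ?U ((1 / 3) * (P * ?Y))" by (simp add: field_simps)
  also have "cg 2 \<dots> ((1 / 3) * (P * ?V))"
    by (intro cg_mult_left 2 Z_div_numeral Z_numeral)
  finally show ?thesis by simp
qed

end

section \<open>Euler numbers and alternating power sums\<close>

text \<open>In terms of the classical Euler polynomials this is 2^m E_m((x + 1) / 2).\<close>

definition euler_poly :: "nat \<Rightarrow> rat \<Rightarrow> rat" where
  "euler_poly m x = fact m * fps_nth (2 / (fps_exp 1 + fps_exp (- 1)) * fps_exp x) m"

lemma sech_fps_mult: "2 / (fps_exp 1 + fps_exp (- 1)) * (fps_exp 1 + fps_exp (- 1)) = (2 :: rat fps)"
proof -
  have "fps_nth (fps_exp 1 + fps_exp (- 1) :: rat fps) 0 \<noteq> 0" by simp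
  then show ?thesis
    by (simp add: fps_divide_unit inverse_mult_eq_1 mult.assoc)
qed

lemma euler_poly_shift: "euler_poly m (x + 1) + euler_poly m (x - 1) = 2 * x ^ m"
proof -
  let ?F = "2 / (fps_exp 1 + fps_exp (- 1)) :: rat fps"
  have "?F * fps_exp (x + 1) + ?F * fps_exp (x - 1) = (?F * (fps_exp 1 + fps_exp (- 1))) * fps_exp x"
    using fps_exp_add_mult[of x 1] fps_exp_add_mult[of x "- 1"] by (simp add: algebra_simps)
  also have "\<dots> = fps_const 2 * fps_exp x" unfolding sech_fps_mult by (simp add: numeral_fps_const)
  finally have "fps_nth (?F * fps_exp (x + 1)) m + fps_nth (?F * fps_exp (x - 1)) m = 2 * (x ^ m / fact m)"
    unfolding fps_add_nth[symmetric] by simp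
  then show ?thesis unfolding euler_poly_def distrib_left[symmetric] by simp
qed

lemma euler_poly_sum: "euler_poly m x = (\<Sum>i\<le>m. of_nat (m choose i) * euler_number i * x ^ (m - i))"
  unfolding euler_poly_def euler_number_def fps_mult_nth sum_distrib_left atLeast0AtMost
  by (intro sum.cong refl) (simp add: binomial_fact)

text \<open>The shift relation at 0 doubles the terms with m - i even and kills the others. After
  halving, the coefficients are integers and i has the parity of m, so integrality and vanishing at
  odd indices follow by induction.\<close>

lemma euler_number_rec:
  "euler_number m = 0 ^ m - (\<Sum>i | i < m \<and> even (m - i). of_nat (m choose i) * euler_number i)"
proof -
  have "2 * 0 ^ m = euler_poly m 1 + euler_poly m (- 1)" using euler_poly_shift[of m 0] by simp
  also have "\<dots> = (\<Sum>i\<le>m. of_nat (m choose i) * euler_number i * (1 + (- 1) ^ (m - i)))"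
    by (simp add: euler_poly_sum distrib_left sum.distrib)
  also have "{..m} = insert m {..<m}" by auto
  also have "(\<Sum>i\<in>insert m {..<m}. of_nat (m choose i) * euler_number i * (1 + (- 1) ^ (m - i))) =
      2 * euler_number m + (\<Sum>i<m. of_nat (m choose i) * euler_number i * (1 + (- 1) ^ (m - i)))"
    by simp
  also have "(\<Sum>i<m. of_nat (m choose i) * euler_number i * (1 + (- 1) ^ (m - i))) =
      (\<Sum>i | i < m \<and> even (m - i). of_nat (m choose i) * euler_number i * (1 + (- 1) ^ (m - i)))"
    by (rule sum.mono_neutral_right) auto
  also have "\<dots> = (\<Sum>i | i < m \<and> even (m - i). 2 * (of_nat (m choose i) * euler_number i))"
    by (rule sum.cong) auto
  finally show ?thesis unfolding sum_distrib_left[symmetric] by simp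
qed

lemma euler_number_Ints: "euler_number m \<in> \<int>"
proof (induction m rule: less_induct)
  case (less m)
  have "0 ^ m \<in> (\<int> :: rat set)" by (intro Ints_power Ints_0)
  moreover have "(\<Sum>i | i < m \<and> even (m - i). of_nat (m choose i) * euler_number i) \<in> \<int>"
    using less by (intro Ints_sum Ints_mult) auto
  ultimately show ?case unfolding euler_number_rec[of m] by (intro Ints_diff)
qed

lemma euler_number_odd: "odd m \<Longrightarrow> euler_number m = 0"
proof (induction m rule: less_induct)
  case (less m)
  have "(\<Sum>i | i < m \<and> even (m - i). of_nat (m choose i) * euler_number i) = 0"
    using less by (intro sum.neutral) auto
  then show ?case unfolding euler_number_rec[of m] using less.prems by (auto elim: oddE)
qed

lemma euler_poly_1:
  assumes "even m" "m > 0"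
  shows "euler_poly m 1 = 0"
proof -
  have "euler_poly m (- 1) = euler_poly m 1"
    unfolding euler_poly_sum
  proof (intro sum.cong refl)
    fix i assume "i \<in> {..m}"
    then show "of_nat (m choose i) * euler_number i * (- 1) ^ (m - i) = of_nat (m choose i) * euler_number i * 1 ^ (m - i)"
      using assms(1) euler_number_odd[of i] by (cases "even i") auto
  qed
  moreover have "euler_poly m 1 + euler_poly m (- 1) = 0"
    using euler_poly_shift[of m 0] assms(2) by simp
  ultimately show ?thesis by simp
qed

text \<open>The shift relation moves the argument by 2, so the sum over even numbers 2j telescopes,
  from argument 1 to 2k + 1. For k = n the upper end is p.\<close>

lemma alternating_power_sum:
  "(\<Sum>j=1..k. (- 1) ^ j * (2 * of_nat j) ^ m) * 2 = (- 1) ^ k * euler_poly m (2 * of_nat k + 1) - euler_poly m 1"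
proof (induction k)
  case (Suc k)
  have "2 * (2 * of_nat (Suc k)) ^ m = euler_poly m (2 * of_nat (Suc k) + 1) + euler_poly m (2 * of_nat k + 1)"
    using euler_poly_shift[of m "2 * of_nat (Suc k)"] by (simp add: algebra_simps)
  then have "(- 1) ^ Suc k * (2 * of_nat (Suc k)) ^ m * 2 =
      (- 1) ^ Suc k * (euler_poly m (2 * of_nat (Suc k) + 1) + euler_poly m (2 * of_nat k + 1))"
    by (metis mult.assoc mult.commute)
  then show ?case
    using Suc by (simp only: sum.cl_ivl_Suc distrib_right) (simp add: distrib_left)
qed simp

context prime_gt_3
begin

lemma Z_euler [simp]: "euler_number m \<in> Z"
  using euler_number_Ints[of m] by (auto elim!: Ints_cases)

text \<open>Euler numbers of odd index vanish, so for even m only even powers of p occur.\<close>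

lemma euler_poly_P:
  assumes "even m" "m > 0"
  shows "cg 2 (euler_poly m P) (euler_number m)"
proof -
  have "{..m} = insert m {..<m}" by auto
  then have "euler_poly m P = (\<Sum>i<m. of_nat (m choose i) * euler_number i * P ^ (m - i)) + euler_number m"
    by (simp add: euler_poly_sum)
  also have "cg 2 \<dots> ((\<Sum>i<m. 0) + euler_number m)"
  proof (intro cg_add cg_sum cg_refl)
    fix i assume i: "i \<in> {..<m}"
    show "cg 2 (of_nat (m choose i) * euler_number i * P ^ (m - i)) 0"
    proof (cases "even i")
      case True
      then have "even (m - i)" "m - i > 0" using i assms(1) by auto
      then have "m - i \<ge> 2" by (cases "m - i = 1") auto
      then have "P ^ (m - i) = P ^ 2 * P ^ (m - i - 2)"
        unfolding power_add[symmetric] by (simp only: le_add_diff_inverse)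
      then show ?thesis
        by (intro cgI[where z = "of_nat (m choose i) * euler_number i * P ^ (m - i - 2)"]) auto
    qed (simp add: euler_number_odd)
  qed
  finally show ?thesis by simp
qed

lemma alternating_power_sum_cong:
  assumes "even n" "even m" "m > 0"
  shows "cg 2 (2 ^ Suc m * (\<Sum>j=1..n. (- 1) ^ j * of_nat j ^ m)) (euler_number m)"
proof -
  have "2 ^ Suc m * (\<Sum>j=1..n. (- 1) ^ j * of_nat j ^ m) = (\<Sum>j=1..n. (- 1) ^ j * (2 * of_nat j) ^ m) * (2::rat)"
    by (simp add: sum_distrib_left sum_distrib_right power_mult_distrib mult_ac)
  also have "\<dots> = euler_poly m P"
    unfolding alternating_power_sum euler_poly_1[OF assms(2,3)] P_n using assms(1) by simp
  finally show ?thesis using euler_poly_P[OF assms(2,3)] by simp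
qed

lemma power_fermat:
  assumes "0 < j" "j < p"
  shows "cg 1 (of_nat j ^ (p - 1)) 1"
proof -
  have "[j ^ (p - 1) = 1] (mod p)"
    using assms by (intro fermat_theorem prime_p) (auto dest: dvd_imp_le)
  then have "[int (j ^ (p - 1)) = int 1] (mod int p ^ 1)"
    unfolding power_one_right cong_int_iff .
  then have "cg 1 (of_int (int (j ^ (p - 1)))) (of_int (int 1))" by (subst cg_int_iff)
  then show ?thesis by simp
qed

text \<open>With j^(p-1) = 1 + p z, the difference of the two sides times j^2 is 1 - 2 (1 + p z) +
  (1 + p z)^2 = (p z)^2.\<close>

lemma inverse_square_cong:
  assumes "0 < j" "j \<le> n"
  shows "cg 2 (1 / of_nat j ^ 2) (2 * of_nat j ^ (p - 3) - of_nat j ^ (2 * p - 4))"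
proof -
  define x where "x = (of_nat j :: rat)"
  define z where "z = (x ^ (p - 1) - 1) / P"
  have x0: "x \<noteq> 0" using assms by (simp add: x_def)
  have zZ: "z \<in> Z" using power_fermat[of j] assms p_n by (simp add: rat_cong_def z_def x_def)
  have inv: "1 / x \<in> Z" unfolding x_def using assms by (intro Z_divide coprime_le_n) auto
  have z: "x ^ (p - 1) = 1 + P * z" by (simp add: z_def)
  have "p - 1 = 2 + (p - 3)" "(p - 1) + (p - 1) = 2 + (2 * p - 4)" using p_gt_3 by auto
  then have pw: "x\<^sup>2 * x ^ (p - 3) = 1 + P * z" "x\<^sup>2 * x ^ (2 * p - 4) = (1 + P * z) * (1 + P * z)"
    unfolding z[symmetric] power_add[symmetric] by simp_all
  have "x\<^sup>2 * (1 / x\<^sup>2) = x\<^sup>2 * (2 * x ^ (p - 3) - x ^ (2 * p - 4) + P\<^sup>2 * (z * (1 / x))\<^sup>2)"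
  proof -
    have "x\<^sup>2 * (2 * x ^ (p - 3) - x ^ (2 * p - 4) + P\<^sup>2 * (z * (1 / x))\<^sup>2) =
       2 * (x\<^sup>2 * x ^ (p - 3)) - x\<^sup>2 * x ^ (2 * p - 4) + P\<^sup>2 * z\<^sup>2"
      using x0 by (simp add: distrib_left right_diff_distrib power_mult_distrib power_divide)
    also have "\<dots> = 1" unfolding pw by (simp add: algebra_simps power2_eq_square)
    finally show ?thesis using x0 by simp
  qed
  then have "1 / x ^ 2 = 2 * x ^ (p - 3) - x ^ (2 * p - 4) + P ^ 2 * (z * (1 / x))\<^sup>2"
    using x0 by (simp only: mult_cancel_left) simp
  then show ?thesis unfolding x_def[symmetric] by (rule cgI) (intro Z_power Z_mult zZ inv)
qed

text \<open>The power sums give 4E / u - 2E' / u^2 with u = 2^(p-1). Replacing u by 1 is possible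
  because the two Euler numbers agree modulo p, a Kummer congruence shown as
  \<open>EE\<close>.\<close>

lemma alternating_harm_2_cong:
  assumes "even n"
  shows "cg 2 (\<Sum>j=1..n. (- 1) ^ j / of_nat j ^ 2) (4 * euler_number (p - 3) - 2 * euler_number (2 * p - 4))"
proof -
  define u :: rat where "u = 2 ^ (p - 1)"
  define S where "S m = (\<Sum>j=1..n. (- 1) ^ j * of_nat j ^ m :: rat)" for m
  define A :: rat where "A = (\<Sum>j=1..n. (- 1) ^ j / of_nat j ^ 2)"
  define E E' where "E = euler_number (p - 3)" and "E' = euler_number (2 * p - 4)"
  have EZ [simp]: "E \<in> Z" "E' \<in> Z" by (simp_all add: E_def E'_def)
  have SZ [simp]: "S m \<in> Z" for m
    unfolding S_def by (intro Z_sum Z_mult Z_power Z_minus Z_numeral Z_of_nat)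
  have uZ [simp]: "u \<in> Z" unfolding u_def by simp
  have u: "u = 1 + P * q" unfolding u_def by (rule power_2_eq)
  have u1: "cg 1 u 1" by (rule cgI[where z = q]) (simp_all add: u)
  have A: "cg 2 A (2 * S (p - 3) - S (2 * p - 4))"
  proof -
    have "A = (\<Sum>j=1..n. (- 1) ^ j * (1 / of_nat j ^ 2))" by (simp add: A_def)
    also have "cg 2 \<dots> (\<Sum>j=1..n. (- 1) ^ j * (2 * of_nat j ^ (p - 3) - of_nat j ^ (2 * p - 4)))"
      by (intro cg_sum cg_mult_left inverse_square_cong Z_power Z_minus) auto
    also have "\<dots> = 2 * S (p - 3) - S (2 * p - 4)"
      by (simp add: S_def right_diff_distrib sum_subtractf sum_distrib_left mult_ac)
    finally show ?thesis .
  qed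
  have ev: "even (p - 3)" "p - 3 > 0" "even (2 * p - 4)" "2 * p - 4 > 0"
    using p_n p_gt_3 by auto
  have pw: "(2::rat) * 2 ^ Suc (p - 3) = u" "(2::rat) * 2 ^ Suc (2 * p - 4) = u * u"
  proof -
    have "Suc (Suc (p - 3)) = p - 1" "Suc (Suc (2 * p - 4)) = (p - 1) + (p - 1)" using p_gt_3 by auto
    then show "(2::rat) * 2 ^ Suc (p - 3) = u" "(2::rat) * 2 ^ Suc (2 * p - 4) = u * u"
      unfolding u_def by (metis power_Suc, metis power_Suc power_add)
  qed
  have E1: "cg 2 (u * S (p - 3)) (2 * E)"
    using cg_mult_left[OF alternating_power_sum_cong[OF assms ev(1,2)], of 2]
    by (simp only: mult.assoc[symmetric] pw S_def E_def Z_numeral)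
  have E2: "cg 2 (u * u * S (2 * p - 4)) (2 * E')"
    using cg_mult_left[OF alternating_power_sum_cong[OF assms ev(3,4)], of 2]
    by (simp only: mult.assoc[symmetric] pw S_def E'_def Z_numeral)
  have SS: "cg 1 (S (p - 3)) (S (2 * p - 4))"
    unfolding S_def
  proof (intro cg_sum cg_mult_left Z_power Z_minus Z_numeral)
    fix j assume j: "j \<in> {1..n}"
    have "2 * p - 4 = (p - 3) + (p - 1)" using p_gt_3 by simp
    then have e: "of_nat j ^ (2 * p - 4) = of_nat j ^ (p - 3) * (of_nat j ^ (p - 1) :: rat)"
      by (simp only: power_add)
    have "cg 1 (of_nat j ^ (p - 3) * 1) (of_nat j ^ (p - 3) * of_nat j ^ (p - 1))"
    proof (intro cg_mult_left cg_sym[OF power_fermat] Z_power Z_of_nat)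
      show "0 < j" "j < p" using j p_n by auto
    qed
    then show "cg 1 (of_nat j ^ (p - 3)) (of_nat j ^ (2 * p - 4))" unfolding e by simp
  qed
  have EE: "cg 1 E E'"
  proof -
    have "cg 1 (2 * E) (u * S (p - 3))" using cg_sym[OF cg_mono[OF E1]] by simp
    also have "cg 1 \<dots> (1 * S (2 * p - 4))" by (intro cg_mult u1 SS) simp_all
    also have "cg 1 \<dots> (u * u * S (2 * p - 4))"
    proof (intro cg_mult_right)
      have "cg 1 (u * u) (1 * 1)" by (intro cg_mult u1) simp_all
      then show "cg 1 1 (u * u)" using cg_sym by simp
    qed simp
    also have "cg 1 \<dots> (2 * E')" using cg_mono[OF E2] by simp
    finally show ?thesis using cg_cancel_nat[of 1 2 E E'] coprime_23 by simp
  qed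
  have "cg 2 (u * u * A) (u * u * (2 * S (p - 3) - S (2 * p - 4)))" by (intro cg_mult_left A) simp
  also have "\<dots> = 2 * u * (u * S (p - 3)) - u * u * S (2 * p - 4)" by (simp add: algebra_simps)
  also have "cg 2 \<dots> (2 * u * (2 * E) - 2 * E')" by (intro cg_diff cg_mult_left E1 E2) simp
  also have "cg 2 \<dots> (u * u * (4 * E - 2 * E'))"
  proof -
    define z where "z = (E - E') / P"
    have z: "E = E' + P * z" "z \<in> Z" using EE by (simp_all add: z_def rat_cong_def)
    \<comment> \<open>The error is -2 (u - 1)^2 E' - 4 u (u - 1) p z, and u - 1 = p q.\<close>
    have *: "2 * u * (2 * E) - 2 * E' = u * u * (4 * E - 2 * E') + P ^ 2 * (- q * (4 * u * z + 2 * q * E'))"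
      unfolding u z(1) by (simp add: algebra_simps power2_eq_square)
    show ?thesis by (rule cgI[OF *]) (simp add: z(2))
  qed
  finally have "cg 2 (u * u * A) (u * u * (4 * E - 2 * E'))" .
  moreover have "cg 1 (u * u) 1" using cg_mult[OF u1 u1] by simp
  ultimately show ?thesis using cg_cancel unit_cong_1 unfolding A_def E_def E'_def by blast
qed

end

section \<open>Morita's Gamma function\<close>

text \<open>With multiples of p replaced by 1 the product over units runs over an interval, which
  gives \<open>morita\<close> a one-step recursion and lets windows be shifted.\<close>

definition unit_part :: "nat \<Rightarrow> nat \<Rightarrow> int" where
  "unit_part p k = (if coprime k p then int k else 1)"

definition morita :: "nat \<Rightarrow> nat \<Rightarrow> int" where
  "morita p k = (- 1) ^ k * (\<Prod>i<k. unit_part p i)"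

lemma morita_eq: "morita p k = (- 1) ^ k * (\<Prod>i | i < k \<and> coprime i p. int i)"
proof -
  have "(\<Prod>i | i < k \<and> coprime i p. int i) = (\<Prod>i<k. unit_part p i)"
    by (rule prod.mono_neutral_cong_left) (auto simp: unit_part_def)
  then show ?thesis by (simp add: morita_def)
qed

lemma morita_Suc: "morita p (Suc k) = - unit_part p k * morita p k"
  by (simp add: morita_def)

lemma cong_power_dvd: "[a = b] (mod int p ^ m) \<Longrightarrow> m \<ge> 1 \<Longrightarrow> [a = b] (mod int p)"
  by (erule cong_dvd_modulus) (simp add: dvd_power)

lemma unit_part_cong:
  assumes "[int a = int b] (mod int p ^ m)" "m \<ge> 1"
  shows "[unit_part p a = unit_part p b] (mod int p ^ m)"
proof -
  have "[int a = int b] (mod int p)" using assms by (rule cong_power_dvd)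
  then have "coprime (int a) (int p) \<longleftrightarrow> coprime (int b) (int p)"
    by (metis cong_imp_coprime cong_sym)
  then show ?thesis using assms(1) by (simp add: unit_part_def)
qed

lemma coprime_unit_part: "coprime (unit_part p k) (int p ^ m)"
  by (simp add: unit_part_def)

text \<open>Inversion permutes the units modulo p^m, so their product equals the product of their
  inverses.\<close>

lemma unit_part_prod_square:
  assumes "p > 1" "m \<ge> 1"
  shows "[(\<Prod>i<p^m. unit_part p i)\<^sup>2 = 1] (mod int p ^ m)"
proof -
  define M where "M = int p ^ m"
  define V where "V = {i. i < p ^ m \<and> coprime i p}"
  define minv where "minv i = nat (modular_inverse M (int i))" for i
  have M: "M > 1" using assms by (simp add: M_def one_less_power)
  have M': "int (p ^ m) = M" by (simp add: M_def)
  have fin: "finite V" by (simp add: V_def)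
  have eq: "(\<Prod>i<p^m. unit_part p i) = (\<Prod>i\<in>V. int i)"
    by (rule prod.mono_neutral_cong_right) (auto simp: V_def unit_part_def)
  have cop: "coprime (int i) M" if "i \<in> V" for i
    using that by (simp add: V_def M_def)
  have int_inv: "int (minv i) = modular_inverse M (int i)" for i
    using modular_inverse_int_nonneg[of M "int i"] M by (simp add: minv_def)
  have cong_inv: "[int i * int (minv i) = 1] (mod M)" if "i \<in> V" for i
    unfolding int_inv using cop[OF that] by (rule cong_modular_inverse1)
  have inv_V: "minv i \<in> V" if "i \<in> V" for i
  proof -
    have "coprime (int (minv i)) M" unfolding int_inv using cop[OF that] by (rule coprime_modular_inverse)
    then have "coprime (minv i) p" using assms(2) by (simp add: M_def)
    moreover have "int (minv i) < int (p ^ m)"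
      unfolding int_inv M' using M by (intro modular_inverse_int_less) simp
    ultimately show ?thesis by (simp add: V_def)
  qed
  have inv_inv: "minv (minv i) = i" if "i \<in> V" for i
  proof -
    have "int i < int (p ^ m)" using that by (simp only: of_nat_less_iff) (simp add: V_def)
    then have "modular_inverse M (int (minv i)) = int i"
      using cong_inv[OF that] unfolding M' by (intro modular_inverse_int_eqI) (simp_all add: mult.commute)
    then show ?thesis by (simp add: minv_def)
  qed
  have "(\<Prod>i\<in>V. int (minv i)) = (\<Prod>i\<in>V. int i)"
    by (rule prod.reindex_bij_witness[of _ minv minv]) (use inv_V inv_inv in auto)
  then have "(\<Prod>i\<in>V. int i)\<^sup>2 = (\<Prod>i\<in>V. int i * int (minv i))"
    by (simp add: prod.distrib power2_eq_square)
  also have "[\<dots> = (\<Prod>i\<in>V. 1)] (mod M)" by (intro cong_prod cong_inv)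
  finally show ?thesis by (simp add: eq M_def)
qed

text \<open>Moving the window by one trades the factor at \<open>a\<close> for the one at a + p^m,
  which is congruent to it; being a unit, it cancels.\<close>

lemma unit_part_prod_period:
  assumes "m \<ge> 1" "p > 0"
  shows "[(\<Prod>i<p^m. unit_part p (a + i)) = (\<Prod>i<p^m. unit_part p i)] (mod int p ^ m)"
proof (induction a)
  case (Suc a)
  let ?Q = "\<lambda>a. \<Prod>i<p^m. unit_part p (a + i)"
  have "unit_part p a * ?Q (Suc a) = (\<Prod>i<Suc (p^m). unit_part p (a + i))"
    by (subst prod.lessThan_Suc_shift) simp
  also have "\<dots> = unit_part p (a + p ^ m) * ?Q a" by simp
  also have "[\<dots> = unit_part p a * ?Q a] (mod int p ^ m)"
    using assms(1) by (intro cong_mult unit_part_cong cong_refl) (simp_all add: cong_def)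
  finally have "[?Q (Suc a) = ?Q a] (mod int p ^ m)"
    using coprime_unit_part by (subst (asm) cong_mult_lcancel)
  then show ?case using Suc cong_trans by blast
qed simp

context prime_gt_3
begin

lemma unit_part_prod: "(\<Prod>i<p. unit_part p i) = fact (p - 1)"
proof -
  have "{..<p} = insert 0 {1..p-1}" using p_gt_3 by auto
  moreover have "unit_part p 0 = 1" using p_gt_3 by (simp add: unit_part_def)
  moreover have "(\<Prod>i=1..p-1. unit_part p i) = (\<Prod>i=1..p-1. int i)"
    using coprime_less by (intro prod.cong) (auto simp: unit_part_def)
  ultimately show ?thesis by (simp add: fact_prod)
qed

text \<open>The square is 1, so the sign remains. Modulo p the product splits into p^(m-1) blocks,
  an odd number, each equal to (p-1)!, that is -1. Hence Q - 1 is a unit, and p^m divides Q +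
  1.\<close>

lemma unit_part_prod_wilson:
  assumes "m \<ge> 1"
  shows "[(\<Prod>i<p^m. unit_part p i) = - 1] (mod int p ^ m)"
proof -
  define Q where "Q = (\<Prod>i<p^m. unit_part p i)"
  have blocks: "[(\<Prod>i<k*p. unit_part p i) = (- 1) ^ k] (mod int p)" for k
  proof (induction k)
    case (Suc k)
    have "(\<Prod>i<Suc k * p. unit_part p i) = (\<Prod>i<k*p. unit_part p i) * (\<Prod>i<p. unit_part p (k * p + i))"
    proof -
      have "(\<Prod>i<a + b. unit_part p i) = (\<Prod>i<a. unit_part p i) * (\<Prod>i<b. unit_part p (a + i))" for a b
        by (induction b) simp_all
      from this[of "k * p" p] show ?thesis by (simp add: add.commute)
    qed
    also have "[\<dots> = (- 1) ^ k * fact (p - 1)] (mod int p)"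
      using unit_part_prod_period[of 1 p "k * p"] by (intro cong_mult Suc) (simp_all add: unit_part_prod)
    also have "[(- 1) ^ k * fact (p - 1) = (- 1) ^ k * (- 1)] (mod int p)"
      using wilson_theorem[OF prime_p] by (intro cong_mult cong_refl)
    finally show ?case by simp
  qed simp
  have "p ^ m = p ^ (m - 1) * p" using assms by (metis Suc_pred' mult.commute power_Suc zero_less_one_class.zero_less_one less_le_trans)
  moreover have "odd (p ^ (m - 1))" using p_n by simp
  ultimately have "[Q = - 1] (mod int p)" using blocks[of "p ^ (m - 1)"] by (simp add: Q_def)
  then have "[Q - 1 = - 2] (mod int p)" using cong_diff[of Q "- 1" "int p" 1 1] by simp
  moreover have "coprime (- 2) (int p)"
    using coprime_23(1) by (metis coprime_int_iff coprime_minus_left_iff of_nat_numeral)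
  ultimately have "coprime (Q - 1) (int p)" using cong_imp_coprime cong_sym by metis
  then have cop: "coprime (int p ^ m) (Q - 1)" by (simp add: coprime_commute)
  have "[Q\<^sup>2 = 1] (mod int p ^ m)"
    unfolding Q_def using assms p_gt_3 by (intro unit_part_prod_square) auto
  then have "int p ^ m dvd (Q - 1) * (Q + 1)"
    by (simp add: cong_iff_dvd_diff algebra_simps power2_eq_square)
  then have "int p ^ m dvd Q + 1" using cop by (simp add: coprime_dvd_mult_right_iff)
  then show ?thesis by (simp add: Q_def cong_iff_dvd_diff)
qed

text \<open>The sign (-1)^(p^m) compensates the -1 of Wilson's theorem; this is what the sign in
  Morita's definition is for.\<close>

lemma morita_period: "[morita p (a + p ^ m) = morita p a] (mod int p ^ m)"
proof (cases "m = 0")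
  case False
  then have m: "m \<ge> 1" by simp
  have "morita p (a + b) = (- 1) ^ b * (\<Prod>i<b. unit_part p (a + i)) * morita p a" for b
    by (induction b) (simp_all add: morita_Suc)
  from this[of "p ^ m"] have "morita p (a + p ^ m) = - (\<Prod>i<p^m. unit_part p (a + i)) * morita p a"
    using p_n by simp
  also have "[\<dots> = - (- 1) * morita p a] (mod int p ^ m)"
    using unit_part_prod_period[OF m p_pos(1), of a] unit_part_prod_wilson[OF m]
    by (intro cong_mult cong_refl) (simp only: cong_minus_minus_iff, rule cong_trans)
  finally show ?thesis by simp
qed simp

lemma morita_cong:
  assumes "[int a = int b] (mod int p ^ m)"
  shows "[morita p a = morita p b] (mod int p ^ m)"
proof -
  have *: "[morita p (r + k * p ^ m) = morita p r] (mod int p ^ m)" for r k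
  proof (induction k)
    case (Suc k)
    have "[morita p (r + k * p ^ m + p ^ m) = morita p (r + k * p ^ m)] (mod int p ^ m)"
      by (rule morita_period)
    then show ?case using Suc cong_trans by (simp add: add_ac) blast
  qed simp
  have "a mod p ^ m = b mod p ^ m"
  proof -
    have "int (a mod p ^ m) = int (b mod p ^ m)" using assms by (simp add: of_nat_mod cong_def)
    then show ?thesis by simp
  qed
  moreover have "[morita p a = morita p (a mod p ^ m)] (mod int p ^ m)"
      "[morita p b = morita p (b mod p ^ m)] (mod int p ^ m)"
    using *[of "a mod p ^ m" "a div p ^ m"] *[of "b mod p ^ m" "b div p ^ m"]
    by (simp_all only: mod_div_mult_eq)
  ultimately show ?thesis using cong_sym cong_trans by metis
qed

text \<open>Resolves the definite description. Existence: by \<open>morita_cong\<close> the value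
  modulo p^m depends only on the argument modulo p^m. Uniqueness: the integers above 1 are
  dense.\<close>

lemma padic_Gamma_component:
  assumes "x \<in> carrier (padic_int p)"
  shows "padic_Gamma p x \<in> carrier (padic_int p)"
    and "padic_Gamma p x m = morita p (nat (x m)) mod int p ^ m"
proof -
  define C where "C = carrier (padic_int p)"
  define g where "g = (\<lambda>x. if x \<in> C then (\<lambda>m. morita p (nat (x m)) mod int p ^ m) else undefined)"
  have nonneg: "int (nat (x m)) = x m" if "x \<in> C" for x m
    using that unfolding C_def padic_int_simps(1) by simp
  have gC: "g x \<in> C" if "x \<in> C" for x
  proof -
    have "[morita p (nat (x (Suc m))) = morita p (nat (x m))] (mod int p ^ m)" for m
      using that padic_SucD[of x p m] nonneg[OF that] by (intro morita_cong) (simp add: C_def)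
    then show ?thesis
      using that unfolding g_def C_def by (simp add: padic_of_fun_closed)
  qed
  have g_int: "g (padic_of_int p (int k)) = padic_of_int p (morita p k)" for k
  proof -
    have "padic_of_int p (int k) \<in> C" by (simp add: C_def padic_of_int_closed)
    moreover have "[morita p (nat (int k mod int p ^ m)) = morita p k] (mod int p ^ m)" for m
      by (intro morita_cong) (simp add: cong_def)
    ultimately show ?thesis by (simp add: g_def padic_of_int_def cong_def)
  qed
  have g_cont: "continuous_on C g"
    unfolding C_def continuous_on_padic_iff
  proof (intro ballI allI)
    fix x m assume "x \<in> carrier (padic_int p)"
    then show "\<exists>k. \<forall>y\<in>carrier (padic_int p). y k = x k \<longrightarrow> g y m = g x m"
      by (intro exI[of _ m]) (simp add: g_def C_def)
  qed
  let ?spec = "\<lambda>g. g \<in> C \<rightarrow>\<^sub>E C \<and> continuous_on C g \<and>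
     (\<forall>k>1. g (padic_of_int p (int k)) = padic_of_int p ((- 1) ^ k * (\<Prod>i | i < k \<and> coprime i p. int i)))"
  have spec: "?spec g"
    using gC g_cont g_int by (auto simp: g_def morita_eq)
  have uniq: "f = g" if "?spec f" for f
  proof
    fix y
    show "f y = g y"
    proof (cases "y \<in> C")
      case y: True
      show ?thesis
      proof
        fix m
        have "\<forall>x\<in>C. \<forall>m. \<exists>k. \<forall>y\<in>C. y k = x k \<longrightarrow> f y m = f x m"
          "\<forall>x\<in>C. \<forall>m. \<exists>k. \<forall>y\<in>C. y k = x k \<longrightarrow> g y m = g x m"
          using that spec unfolding C_def continuous_on_padic_iff by blast+
        then obtain k1 k2 where
          k: "\<And>z. z \<in> C \<Longrightarrow> z k1 = y k1 \<Longrightarrow> f z m = f y m" "\<And>z. z \<in> C \<Longrightarrow> z k2 = y k2 \<Longrightarrow> g z m = g y m"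
          using y by metis
        define K where "K = k1 + k2 + 1"
        \<comment> \<open>Adding p^K keeps the residues up to level K and pushes the integer above
          1, where the values are prescribed.\<close>
        define a where "a = nat (y K) + p ^ K"
        have "p \<le> p ^ K" by (rule self_le_power) (use p_gt_3 in \<open>simp_all add: K_def\<close>)
        then have "a > 1" using p_gt_3 by (simp add: a_def)
        have zC: "padic_of_int p (int a) \<in> C" by (simp add: C_def padic_of_int_closed)
        have "padic_of_int p (int a) j = y j" if "j \<le> K" for j
        proof -
          have "[int a = y K] (mod int p ^ j)"
            using that nonneg[OF y] by (simp add: a_def cong_def le_imp_power_dvd mod_add_right_eq dvd_imp_mod_0 mod_add_eq[of "y K" _ "int p ^ K", symmetric])
          then show ?thesis using padic_le_eq[of y p j K] y that by (simp add: padic_of_int_def C_def cong_def)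
        qed
        then have "f (padic_of_int p (int a)) m = f y m" "g (padic_of_int p (int a)) m = g y m"
          using zC by (intro k; simp add: K_def)+
        moreover have "f (padic_of_int p (int a)) = g (padic_of_int p (int a))"
          using that spec \<open>a > 1\<close> by metis
        ultimately show "f y m = g y m" by simp
      qed
    next
      case False
      have "f y = undefined" "g y = undefined"
        using PiE_arb[OF conjunct1[OF that] False] PiE_arb[OF conjunct1[OF spec] False] by simp_all
      then show ?thesis by simp
    qed
  qed
  have "padic_Gamma p = (THE f. ?spec f)" by (simp only: padic_Gamma_def C_def)
  also have "\<dots> = g" using spec uniq by (rule the_equality)
  finally have "padic_Gamma p = g" .
  then show "padic_Gamma p x \<in> carrier (padic_int p)"
    "padic_Gamma p x m = morita p (nat (x m)) mod int p ^ m"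
    using gC[of x] assms by (simp_all add: C_def g_def)
qed

section \<open>The fourth power of the Gamma value modulo p^2\<close>

text \<open>Corrections to factorials are kept in the form 1 + p a: modulo p^2 they combine by
  adding the a, which matter only modulo p.\<close>

lemma linear_mult: "a \<in> Z \<Longrightarrow> b \<in> Z \<Longrightarrow> cg 2 ((1 + P * a) * (1 + P * b)) (1 + P * (a + b))"
  by (rule cgI[where z = "a * b"]) (simp_all add: algebra_simps power2_eq_square)

lemma linear_cong: "cg 1 a b \<Longrightarrow> cg 2 (1 + P * a) (1 + P * b)"
  using cg_P_iff[of 1 a b] by (intro cg_add cg_refl) (simp add: numeral_2_eq_2 One_nat_def)

lemma linear_power: "a \<in> Z \<Longrightarrow> cg 2 ((1 + P * a) ^ k) (1 + P * (of_nat k * a))"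
  using cg_prod_2[of "{..<k}" "\<lambda>_. a"] by simp

lemma linear_cancel: "cg 2 ((1 + P * a) * x) ((1 + P * a) * y) \<Longrightarrow> a \<in> Z \<Longrightarrow> cg 2 x y"
  using unit_cong_1[of "1 + P * a"] cgI[of "1 + P * a" 1 1 a] cg_cancel by simp

lemma fact_Z [simp]: "fact k \<in> Z"
  using Z_of_nat[of "fact k"] by simp

lemma fact_reflect:
  assumes "m < p"
  shows "cg 2 (fact (p - 1)) (fact (p - 1 - m) * ((- 1) ^ m * fact m) * (1 + P * - gen_harm 1 m))"
proof -
  have "(\<Prod>k=1..m. P - of_nat k) = (\<Prod>k=1..m. (- 1) * of_nat k * (1 + P * - (1 / of_nat k)))"
    by (intro prod.cong refl) (simp add: field_simps)
  also have "\<dots> = (- 1) ^ m * fact m * (\<Prod>k=1..m. 1 + P * - (1 / of_nat k))"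
    by (simp only: prod.distrib prod_constant card_atLeastAtMost fact_prod of_nat_prod) simp
  finally have "(fact (p - 1) :: rat) = fact (p - 1 - m) * ((- 1) ^ m * fact m) * (\<Prod>k=1..m. 1 + P * - (1 / of_nat k))"
    unfolding fact_prod_rev[OF assms] by simp
  also have "cg 2 \<dots> (fact (p - 1 - m) * ((- 1) ^ m * fact m) * (1 + P * (\<Sum>k=1..m. - (1 / of_nat k))))"
  proof (intro cg_mult_left cg_prod_2)
    fix k assume "k \<in> {1..m}"
    then show "- (1 / of_nat k) \<in> Z" using assms by (intro Z_minus Z_divide coprime_less) auto
  qed simp_all
  finally show ?thesis by (simp add: gen_harm_def sum_negf)
qed

section \<open>The Wilson quotient and the blocks of length p\<close>

abbreviation w :: rat where "w \<equiv> - fact (p - 1)"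

lemma w_cong: "cg 1 w 1"
proof -
  have "[- fact (p - 1) = - (- 1)] (mod int p)"
    using wilson_theorem[OF prime_p] by (simp only: cong_minus_minus_iff)
  then have "cg 1 (of_int (- fact (p - 1))) (of_int (- (- 1)))"
    unfolding cg_int_iff by (simp add: One_nat_def)
  then show ?thesis by simp
qed

text \<open>w = 1 + p z with z the negative Wilson quotient; in the p-th power its correction
  becomes p^2 z.\<close>

lemma w_power_p: "cg 2 (w ^ p) 1"
proof -
  define z where "z = (w - 1) / P"
  have z: "w = 1 + P * z" "z \<in> Z" using w_cong by (simp_all add: z_def rat_cong_def)
  have "cg 2 ((1 + P * z) ^ p) (1 + P * (P * z))" using linear_power[OF z(2), of p] by simp
  also have "cg 2 \<dots> 1" by (rule cgI[where z = z]) (simp_all add: z(2) power2_eq_square)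
  finally show ?thesis unfolding z(1) .
qed

lemma w_power_cancel: "cg 2 (w ^ k * x) (w ^ k * y) \<Longrightarrow> cg 2 x y"
  using cg_cancel[of 2 "w ^ k" x y] unit_cong_1[of "w ^ k"] cg_power[OF w_cong, of k] by simp

text \<open>Within a block no multiple of p occurs, and i p + j = j (1 + p i / j).\<close>

lemma morita_block:
  assumes "s < p"
  shows "of_int (morita p (i * p + 1 + s)) =
    (of_int (morita p (i * p + 1)) * ((- 1) ^ s * fact s * (\<Prod>j=1..s. 1 + P * (of_nat i / of_nat j))) :: rat)"
  using assms
proof (induction s)
  case (Suc s)
  have "gcd p (i * p + Suc s) = gcd p (Suc s)" by (rule gcd_add_mult)
  moreover have "i * p + 1 + s = i * p + Suc s" by simp
  ultimately have "coprime (i * p + 1 + s) p"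
    using coprime_less[of "Suc s"] Suc.prems by (simp only: coprime_iff_gcd_eq_1 gcd.commute zero_less_Suc)
  then have u: "unit_part p (i * p + 1 + s) = int (i * p + 1 + s)" by (simp add: unit_part_def)
  have "(of_int (morita p (i * p + 1 + Suc s)) :: rat) =
      - (of_nat (Suc s) * (1 + P * (of_nat i / of_nat (Suc s)))) * of_int (morita p (i * p + 1 + s))"
  proof -
    have "of_nat (Suc s) * (1 + P * (of_nat i / of_nat (Suc s))) = (of_int (int (i * p + 1 + s)) :: rat)"
      by (simp add: field_simps)
    moreover have "morita p (i * p + 1 + Suc s) = - int (i * p + 1 + s) * morita p (i * p + 1 + s)"
      using morita_Suc[of p "i * p + 1 + s"] unfolding u by simp
    ultimately show ?thesis by (simp only: of_int_mult of_int_minus)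
  qed
  then show ?case using Suc by (simp add: mult_ac del: of_nat_Suc)
qed simp

lemma morita_block_cong:
  assumes "s < p"
  shows "cg 2 (of_int (morita p (i * p + 1 + s)))
    (of_int (morita p (i * p + 1)) * ((- 1) ^ s * fact s * (1 + P * (of_nat i * gen_harm 1 s))))"
proof -
  have "cg 2 (\<Prod>j=1..s. 1 + P * (of_nat i / of_nat j)) (1 + P * (\<Sum>j=1..s. of_nat i / of_nat j))"
  proof (rule cg_prod_2)
    fix j assume "j \<in> {1..s}"
    then show "of_nat i / of_nat j \<in> Z" using assms by (intro Z_divide coprime_less) auto
  qed simp
  also have "(\<Sum>j=1..s. of_nat i / of_nat j) = of_nat i * gen_harm 1 s"
    by (simp add: gen_harm_def sum_distrib_left)
  finally show ?thesis unfolding morita_block[OF assms] by (intro cg_mult_left) simp_all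
qed

text \<open>A full block contributes (p-1)! without correction, as H_{p-1} vanishes modulo p; the
  multiple of p after it contributes only a sign.\<close>

lemma morita_block_start: "cg 2 (of_int (morita p (i * p + 1))) (- (w ^ i))"
proof (induction i)
  case 0
  have "morita p 1 = - 1" using p_gt_3 by (simp add: morita_def unit_part_def One_nat_def)
  then show ?case by simp
next
  case (Suc i)
  have nc: "\<not> coprime (Suc i * p) p"
  proof
    assume "coprime (Suc i * p) p"
    then have "is_unit p" by (rule coprime_common_divisor) simp_all
    then show False using p_gt_3 by simp
  qed
  have "morita p (Suc i * p + 1) = - morita p (i * p + 1 + (p - 1))"
  proof -
    have "Suc i * p + 1 = Suc (Suc i * p)" "i * p + 1 + (p - 1) = Suc i * p" using p_gt_3 by simp_all
    then show ?thesis
      using morita_Suc[of p "Suc i * p"] nc by (simp only: unit_part_def) simp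
  qed
  then have "of_int (morita p (Suc i * p + 1)) = (- 1) * (of_int (morita p (i * p + 1 + (p - 1))) :: rat)" by simp
  also have "cg 2 \<dots> ((- 1) * (of_int (morita p (i * p + 1)) *
      ((- 1) ^ (p - 1) * fact (p - 1) * (1 + P * (of_nat i * gen_harm 1 (p - 1))))))"
    using p_gt_3 by (intro cg_mult_left morita_block_cong) simp_all
  also have "\<dots> = of_int (morita p (i * p + 1)) * (w * (1 + P * (of_nat i * gen_harm 1 (p - 1))))"
    using p_n by simp
  also have "cg 2 \<dots> (- (w ^ i) * (w * (1 + P * 0)))"
  proof (intro cg_mult[OF Suc] cg_mult_left linear_cong)
    have "cg 1 (of_nat i * gen_harm 1 (p - 1)) (of_nat i * 0)"
      using harm_full by (intro cg_mult_left) simp_all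
    then show "cg 1 (of_nat i * gen_harm 1 (p - 1)) 0" by simp
  qed simp_all
  finally show ?case by (simp add: mult_ac)
qed

lemma morita_4th_power:
  assumes "s < p"
  shows "cg 2 (of_int (morita p (i * p + 1 + s)) ^ 4) (w ^ (4 * i) * fact s ^ 4 * (1 + P * (4 * of_nat i * gen_harm 1 s)))"
proof -
  let ?H = "gen_harm 1 s"
  have HZ: "?H \<in> Z" using assms by simp
  have "cg 2 (of_int (morita p (i * p + 1 + s))) (- (w ^ i) * ((- 1) ^ s * fact s * (1 + P * (of_nat i * ?H))))"
    using morita_block_cong[OF assms, of i]
  proof (rule cg_trans)
    show "cg 2 (of_int (morita p (i * p + 1)) * ((- 1) ^ s * fact s * (1 + P * (of_nat i * ?H))))
       (- (w ^ i) * ((- 1) ^ s * fact s * (1 + P * (of_nat i * ?H))))"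
      using HZ by (intro cg_mult_right morita_block_start) simp
  qed
  then have "cg 2 (of_int (morita p (i * p + 1 + s)) ^ 4) ((- (w ^ i) * ((- 1) ^ s * fact s * (1 + P * (of_nat i * ?H)))) ^ 4)"
    using HZ by (intro cg_power) simp_all
  also have "\<dots> = (w ^ (4 * i) * fact s ^ 4) * (1 + P * (of_nat i * ?H)) ^ 4"
  proof -
    have "((- 1) ^ s) ^ 4 = (1 :: rat)" by (simp flip: power_mult)
    then show ?thesis by (simp add: power_mult_distrib mult.commute[of 4] power_mult)
  qed
  also have "cg 2 \<dots> ((w ^ (4 * i) * fact s ^ 4) * (1 + P * (of_nat 4 * (of_nat i * ?H))))"
    using HZ by (intro cg_mult_left linear_power) simp_all
  finally show ?thesis by (simp add: mult.assoc)
qed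

text \<open>Both sides are -3H/2 modulo p. This is the relation that absorbs 2^(p-1) = 1 + p q in
  the two evaluations of the Gamma value.\<close>

lemma quotient_harm: "cg 1 (q - H) (- gen_harm 1 (n div 2))"
proof -
  let ?h = "gen_harm 1 (n div 2)"
  have "cg 1 (2 * q + H) (2 * q + - 2 * q)" by (intro cg_add cg_refl H_cong_1)
  then have 1: "cg 1 (2 * q + H) 0" by simp
  have "cg 1 (2 * (q - H)) (2 * q + H - 3 * H)" by simp
  also have "cg 1 \<dots> (0 - 2 * ?h)" by (intro cg_diff 1 cg_sym[OF harm_half])
  finally show ?thesis using cg_cancel_nat[of 1 2 "q - H" "- ?h"] coprime_23 by simp
qed

lemma div2_less: "n div 2 < p" "n < p"
  using p_n by linarith+

text \<open>For p = 4h + 3 the base-p digits of N - 1 are 3h + 2 and h, so w occurs to the power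
  4(3h + 2) = 3p - 1. One more factor w completes w^(3p); that factor is n!^2 (1 - p H) by
  reflection at the middle.\<close>

lemma gamma_3_mod_4:
  assumes "odd n" "4 * N = 3 * p\<^sup>2 + 1"
  shows "cg 2 (of_int (morita p N) ^ 4 * fact n ^ 2) (2 ^ (p - 1) * fact (n div 2) ^ 4)"
proof -
  define h where "h = n div 2"
  let ?G = "of_int (morita p N) :: rat" and ?h = "gen_harm 1 h"
  have ph: "p = 4 * h + 3" using assms(1) p_n by (auto simp: h_def elim: oddE)
  have hp: "h < p" using ph by simp
  have hZ [simp]: "?h \<in> Z" using hp by simp
  have N: "N = (3 * h + 2) * p + 1 + h"
  proof -
    have "4 * N = 4 * ((3 * h + 2) * p + 1 + h)"
      unfolding assms(2) unfolding ph by (simp add: algebra_simps power2_eq_square)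
    then show ?thesis by simp
  qed
  have e: "4 * (3 * h + 2) + 1 = 3 * p" using ph by simp
  then have e': "4 * of_nat (3 * h + 2) = 3 * P - 1"
    by (metis add_diff_cancel_right' of_nat_1 of_nat_add of_nat_mult of_nat_numeral)
  have "cg 2 (?G ^ 4 * w) (w ^ (4 * (3 * h + 2)) * fact h ^ 4 * (1 + P * (4 * of_nat (3 * h + 2) * ?h)) * w)"
    using morita_4th_power[OF hp, of "3 * h + 2"] unfolding N by (intro cg_mult_right) simp_all
  also have "\<dots> = w ^ (3 * p) * (fact h ^ 4 * (1 + P * ((3 * P - 1) * ?h)))"
    unfolding e' e[symmetric] power_add by (simp add: mult_ac)
  also have "cg 2 \<dots> (1 ^ 3 * (fact h ^ 4 * (1 + P * - ?h)))"
  proof (intro cg_mult cg_mult_left linear_cong)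
    show "cg 2 (w ^ (3 * p)) (1 ^ 3)"
      using cg_power[OF w_power_p, of 3] by (simp add: mult.commute[of 3] power_mult)
    show "cg 1 ((3 * P - 1) * ?h) (- ?h)"
      by (rule cgI[where z = "3 * ?h"]) (simp_all add: algebra_simps)
  qed simp_all
  finally have G: "cg 2 (?G ^ 4 * w) (fact h ^ 4 * (1 + P * - ?h))" by simp
  have w: "cg 2 w (fact n ^ 2 * (1 + P * - H))"
  proof -
    have "p - 1 - n = n" using p_n by simp
    then show ?thesis
      using cg_minus[OF fact_reflect[OF div2_less(2)]] assms(1) by (simp add: power2_eq_square)
  qed
  have "cg 2 ((1 + P * - H) * (?G ^ 4 * fact n ^ 2)) (?G ^ 4 * w)"
    using cg_mult_left[OF cg_sym[OF w], of "?G ^ 4"] by (simp add: mult_ac)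
  also note G
  also have "cg 2 (fact h ^ 4 * (1 + P * - ?h)) (fact h ^ 4 * ((1 + P * q) * (1 + P * - H)))"
  proof (intro cg_mult_left)
    have "cg 2 ((1 + P * q) * (1 + P * - H)) (1 + P * (q + - H))" by (rule linear_mult) simp_all
    also have "cg 2 \<dots> (1 + P * - ?h)" using quotient_harm by (intro linear_cong) (simp add: h_def)
    finally show "cg 2 (1 + P * - ?h) ((1 + P * q) * (1 + P * - H))" by (rule cg_sym)
  qed simp
  also have "\<dots> = (1 + P * - H) * (2 ^ (p - 1) * fact h ^ 4)" unfolding power_2_eq by (simp add: mult_ac)
  finally show ?thesis unfolding h_def by (rule linear_cancel) simp
qed

text \<open>For p = 4h + 1 both base-p digits of N - 1 are 3h, and the exponent 3p - 3 of w lacks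
  three factors. Reflection writes (p-1)! through (3h)! and h!, and its fourth power supplies w^4;
  three factors cancel, and the fourth is -n!^2 up to a correction.\<close>

lemma gamma_1_mod_4:
  assumes "even n" "4 * N = 3 * p\<^sup>2 + 1"
  shows "cg 2 (- (of_int (morita p N) ^ 4 * (2 ^ (p - 1) * fact (n div 2) ^ 4))) (fact n ^ 2)"
proof -
  define h where "h = n div 2"
  let ?G = "of_int (morita p N) :: rat" and ?h = "gen_harm 1 h"
  have ph: "p = 4 * h + 1" using assms(1) p_n by (auto simp: h_def elim: evenE)
  have hp: "h < p" "3 * h < p" using ph by simp_all
  have hZ [simp]: "?h \<in> Z" "gen_harm 1 (3 * h) \<in> Z" using hp by simp_all
  have N: "N = 3 * h * p + 1 + 3 * h"
  proof -
    have "4 * N = 4 * (3 * h * p + 1 + 3 * h)"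
      unfolding assms(2) unfolding ph by (simp add: algebra_simps power2_eq_square)
    then show ?thesis by simp
  qed
  have e: "4 * (3 * h) + 3 = 3 * p" using ph by simp
  then have e': "4 * of_nat (3 * h) = 3 * P - 3"
    by (metis add_diff_cancel_right' of_nat_add of_nat_mult of_nat_numeral)
  have "p - 1 - h = 3 * h" using ph by simp
  then have refl: "cg 1 (gen_harm 1 (3 * h)) ?h"
      "cg 2 (fact (p - 1)) (fact (3 * h) * ((- 1) ^ h * fact h) * (1 + P * - ?h))"
    using harm_reflect[OF hp(1)] fact_reflect[OF hp(1)] by simp_all
  have "cg 2 (?G ^ 4 * w ^ 3) (w ^ (4 * (3 * h)) * fact (3 * h) ^ 4 *
      (1 + P * (4 * of_nat (3 * h) * gen_harm 1 (3 * h))) * w ^ 3)"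
    using morita_4th_power[OF hp(2), of "3 * h"] unfolding N by (intro cg_mult_right) simp_all
  also have "\<dots> = w ^ (3 * p) * (fact (3 * h) ^ 4 * (1 + P * ((3 * P - 3) * gen_harm 1 (3 * h))))"
    unfolding e' e[symmetric] power_add by (simp add: mult_ac)
  also have "cg 2 \<dots> (1 ^ 3 * (fact (3 * h) ^ 4 * (1 + P * (- 3 * ?h))))"
  proof -
    have a: "cg 2 (w ^ (3 * p)) (1 ^ 3)"
      using cg_power[OF w_power_p, of 3] by (simp add: mult.commute[of 3] power_mult)
    have "cg 1 ((3 * P - 3) * gen_harm 1 (3 * h)) (- 3 * gen_harm 1 (3 * h))"
    proof (rule cgI)
      show "(3 * P - 3) * gen_harm 1 (3 * h) = - 3 * gen_harm 1 (3 * h) + P ^ 1 * (3 * gen_harm 1 (3 * h))"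
        by (simp add: algebra_simps)
    qed simp
    also have "cg 1 \<dots> (- 3 * ?h)" using refl(1) by (intro cg_mult_left) simp_all
    finally have b: "cg 1 ((3 * P - 3) * gen_harm 1 (3 * h)) (- 3 * ?h)" .
    show ?thesis by (intro cg_mult[OF a] cg_mult_left linear_cong[OF b]) simp_all
  qed
  finally have G: "cg 2 (?G ^ 4 * w ^ 3) (fact (3 * h) ^ 4 * (1 + P * (- 3 * ?h)))" by simp
  have "cg 2 (fact (p - 1) ^ 4) ((fact (3 * h) * ((- 1) ^ h * fact h) * (1 + P * - ?h)) ^ 4)"
    by (intro cg_power refl) simp
  also have "\<dots> = fact (3 * h) ^ 4 * fact h ^ 4 * (1 + P * - ?h) ^ 4"
  proof -
    have "((- 1) ^ h) ^ 4 = (1 :: rat)" by (simp flip: power_mult)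
    then show ?thesis by (simp add: power_mult_distrib)
  qed
  also have "cg 2 \<dots> (fact (3 * h) ^ 4 * fact h ^ 4 * (1 + P * (of_nat 4 * - ?h)))"
    by (intro cg_mult_left linear_power) simp_all
  finally have w4: "cg 2 (w ^ 4) (fact (3 * h) ^ 4 * fact h ^ 4 * (1 + P * (of_nat 4 * - ?h)))" by simp
  have w: "cg 2 (- w) (fact n ^ 2 * (1 + P * - H))"
  proof -
    have "p - 1 - n = n" using p_n by simp
    then show ?thesis using fact_reflect[OF div2_less(2)] assms(1) by (simp add: power2_eq_square)
  qed
  have "cg 2 (?G ^ 4 * w ^ 3 * (fact h ^ 4 * (1 + P * (of_nat 4 * - ?h))))
      (fact (3 * h) ^ 4 * (1 + P * (- 3 * ?h)) * (fact h ^ 4 * (1 + P * (of_nat 4 * - ?h))))"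
    by (intro cg_mult_right G) simp
  also have "\<dots> = fact (3 * h) ^ 4 * fact h ^ 4 * (1 + P * (of_nat 4 * - ?h)) * (1 + P * (- 3 * ?h))"
    by (simp add: mult_ac)
  also have "cg 2 \<dots> (w ^ 4 * (1 + P * (- 3 * ?h)))" by (intro cg_mult_right cg_sym[OF w4]) simp
  also have "\<dots> = w ^ 3 * (w * (1 + P * (- 3 * ?h)))" by (simp add: power4_eq_xxxx power3_eq_cube mult.assoc)
  finally have "cg 2 (w ^ 3 * (?G ^ 4 * fact h ^ 4 * (1 + P * (of_nat 4 * - ?h)))) (w ^ 3 * (w * (1 + P * (- 3 * ?h))))"
    by (simp only: mult_ac)
  then have 1: "cg 2 (?G ^ 4 * fact h ^ 4 * (1 + P * (of_nat 4 * - ?h))) (w * (1 + P * (- 3 * ?h)))"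
    by (rule w_power_cancel)
  \<comment> \<open>The total correction q - H - 3 H_h is -4 H_h modulo p by
    \<open>quotient_harm\<close>.\<close>
  have lin: "cg 2 ((1 + P * q) * ((1 + P * - H) * (1 + P * (- 3 * ?h)))) (1 + P * (of_nat 4 * - ?h))"
  proof -
    have "cg 2 ((1 + P * q) * (1 + P * - H) * (1 + P * (- 3 * ?h))) ((1 + P * (q + - H)) * (1 + P * (- 3 * ?h)))"
      by (intro cg_mult_right linear_mult) simp_all
    also have "cg 2 \<dots> (1 + P * (q + - H + - 3 * ?h))" by (rule linear_mult) simp_all
    also have "cg 2 \<dots> (1 + P * (of_nat 4 * - ?h))"
    proof (rule linear_cong)
      have "cg 1 (q - H + - 3 * ?h) (- ?h + - 3 * ?h)"
        using quotient_harm by (intro cg_add cg_refl) (simp add: h_def)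
      then show "cg 1 (q + - H + - 3 * ?h) (of_nat 4 * - ?h)" by simp
    qed
    finally show ?thesis by (simp only: mult.assoc)
  qed
  have "cg 2 (- (?G ^ 4 * fact h ^ 4 * ((1 + P * q) * ((1 + P * - H) * (1 + P * (- 3 * ?h))))))
      (- (?G ^ 4 * fact h ^ 4 * (1 + P * (of_nat 4 * - ?h))))"
    by (intro cg_minus cg_mult_left lin) simp
  also have "cg 2 \<dots> (- (w * (1 + P * (- 3 * ?h))))" by (rule cg_minus[OF 1])
  also have "\<dots> = (- w) * (1 + P * (- 3 * ?h))" by simp
  also have "cg 2 \<dots> (fact n ^ 2 * (1 + P * - H) * (1 + P * (- 3 * ?h)))" by (intro cg_mult_right w) simp
  finally have "cg 2 ((1 + P * - H) * ((1 + P * (- 3 * ?h)) * - (?G ^ 4 * ((1 + P * q) * fact h ^ 4))))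
      ((1 + P * - H) * ((1 + P * (- 3 * ?h)) * fact n ^ 2))"
    by (simp add: mult_ac)
  then have "cg 2 ((1 + P * (- 3 * ?h)) * - (?G ^ 4 * ((1 + P * q) * fact h ^ 4))) ((1 + P * (- 3 * ?h)) * fact n ^ 2)"
    by (rule linear_cancel) simp
  then show ?thesis unfolding power_2_eq h_def[symmetric] by (rule linear_cancel) simp
qed

section \<open>Transfer to the p-adic integers\<close>

text \<open>Only components modulo p^2 are compared, so the Gamma value can be represented by an
  integer that it need not equal.\<close>

definition represents :: "(nat \<Rightarrow> int) \<Rightarrow> rat \<Rightarrow> bool" where
  "represents x a \<longleftrightarrow> x \<in> carrier (padic_int p) \<and> cg 2 (of_int (x 2)) a"

lemma represents_Z: "represents x a \<Longrightarrow> a \<in> Z"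
  unfolding represents_def using cg_Z cg_sym Z_of_int by blast

lemma cg_of_int_mod: "cg k (of_int (a mod int p ^ k)) (of_int a)"
  unfolding cg_int_iff by (simp add: cong_def)

lemma represents_mult:
  assumes "represents x a" "represents y b"
  shows "represents (x \<otimes>\<^bsub>padic_int p\<^esub> y) (a * b)"
proof -
  interpret cring "padic_int p" by (rule padic_int_cring) simp
  have "cg 2 (of_int (x 2 * y 2)) (a * b)"
    unfolding of_int_mult using assms represents_Z[OF assms(2)] by (intro cg_mult) (auto simp: represents_def)
  then show ?thesis
    using assms cg_trans[OF cg_of_int_mod] by (simp add: represents_def) (simp add: padic_int_simps(2))
qed

lemma represents_uminus:
  assumes "represents x a"
  shows "represents (\<ominus>\<^bsub>padic_int p\<^esub> x) (- a)"
proof -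
  interpret cring "padic_int p" by (rule padic_int_cring) simp
  let ?y = "\<ominus>\<^bsub>padic_int p\<^esub> x"
  have x: "x \<in> carrier (padic_int p)" using assms by (simp add: represents_def)
  have "x \<oplus>\<^bsub>padic_int p\<^esub> ?y = \<zero>\<^bsub>padic_int p\<^esub>" using x by (rule r_neg)
  then have "(x 2 + ?y 2) mod int p ^ 2 = 0"
    unfolding padic_int_simps(3,5) by (rule fun_cong)
  then have "[x 2 + ?y 2 = 0] (mod int p ^ 2)" by (simp add: cong_def)
  then have "cg 2 (of_int (x 2 + ?y 2)) (of_int 0)" unfolding cg_int_iff .
  then have "cg 2 (of_int (x 2 + ?y 2) - of_int (x 2)) (of_int 0 - a)"
    using assms by (intro cg_diff) (auto simp: represents_def)
  then show ?thesis using x by (simp add: represents_def)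
qed

lemma represents_power:
  assumes "represents x a"
  shows "represents (x [^]\<^bsub>padic_int p\<^esub> (k::nat)) (a ^ k)"
proof -
  interpret cring "padic_int p" by (rule padic_int_cring) simp
  show ?thesis
  proof (induction k)
    case 0
    have "cg 2 (of_int (1 mod int p ^ 2)) (of_int 1)" by (rule cg_of_int_mod)
    then show ?case using one_closed by (simp add: represents_def) (simp add: padic_int_simps(4))
  next
    case (Suc k)
    show ?case using represents_mult[OF Suc assms] by (simp add: mult.commute)
  qed
qed

lemma padic_cong_represents:
  assumes "represents x a" "represents y b" "cg 2 a b"
  shows "padic_cong p 2 x y"
proof -
  have "cg 2 (of_int (x 2)) (of_int (y 2))"
    using assms unfolding represents_def by (blast intro: cg_trans cg_sym)
  then have "[x 2 = y 2] (mod int p ^ 2)" unfolding cg_int_iff .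
  then have "x 2 = y 2"
    using padic_modD[of x p 2] padic_modD[of y p 2] assms by (simp add: represents_def cong_def)
  then show ?thesis using assms by (simp add: padic_cong_iff represents_def)
qed

lemma padic_of_rat_cong:
  assumes "x \<in> Z"
  shows "padic_of_rat p x \<in> carrier (padic_int p)" "cg k (of_int (padic_of_rat p x k)) x"
proof -
  obtain a b where ab: "quotient_of x = (a, b)" by (cases "quotient_of x")
  then have x: "x = of_int a / of_int b" "b > 0" "coprime a b"
    by (rule quotient_of_div, rule quotient_of_denom_pos, rule quotient_of_coprime)
  obtain a' b' where x': "coprime b' (int p)" "x = of_int a' / of_int b'"
    using assms unfolding p_integral_def by auto
  have "of_int (a * b') = (of_int (a' * b) :: rat)"
    using x x' coprime_nz[of b'] by (simp add: field_simps)
  then have "a * b' = a' * b" by (simp only: of_int_eq_iff)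
  \<comment> \<open>The reduced denominator divides every denominator of \<open>x\<close>, so it is
    prime to p, as \<open>padic_of_rat\<close> requires.\<close>
  then have "b dvd a * b'" by simp
  then have "b dvd b'" using x(3) by (simp add: coprime_dvd_mult_right_iff coprime_commute)
  then have b: "coprime b (int p)" using coprime_divisors[OF _ dvd_refl x'(1)] by simp
  let ?r = "padic_of_rat p x"
  show "?r \<in> carrier (padic_int p)" by (rule padic_of_rat_eq(1)[OF prime_p ab b])
  have "(padic_of_int p b \<otimes>\<^bsub>padic_int p\<^esub> ?r) k = padic_of_int p a k"
    unfolding padic_of_rat_eq(2)[OF prime_p ab b] ..
  then have "[b * ?r k = a] (mod int p ^ k)"
    by (simp add: padic_int_simps(2) padic_of_int_def cong_def mod_simps)
  then have "cg k (of_int (b * ?r k)) (of_int a)" unfolding cg_int_iff .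
  then have "cg k (of_int b * of_int (?r k)) (of_int b * x)" using x by simp
  moreover have "inverse (of_int b) \<in> Z" using b x(2) by (intro Z_I[of b _ 1]) (simp_all add: divide_simps)
  ultimately show "cg k (of_int (?r k)) x" by (rule cg_cancel) (use x(2) in simp)
qed

lemma represents_of_rat: "a \<in> Z \<Longrightarrow> represents (padic_of_rat p a) a"
  by (simp add: represents_def padic_of_rat_cong)

text \<open>N - 1/4 = 3p^2/4, and N is an integer for either residue of p modulo 4 because p^2 is 1
  modulo 4.\<close>

lemma represents_Gamma_quarter:
  assumes "4 * N = 3 * p\<^sup>2 + 1"
  shows "represents (padic_Gamma p (padic_of_rat p (1 / 4))) (of_int (morita p N))"
proof -
  let ?x = "padic_of_rat p (1 / 4)"
  have Z: "1 / 4 \<in> Z" by (intro Z_div_numeral Z_numeral)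
  have x: "?x \<in> carrier (padic_int p)" by (rule padic_of_rat_cong[OF Z])
  have "4 * of_nat N = (3 * P\<^sup>2 + 1 :: rat)"
    by (metis assms of_nat_1 of_nat_add of_nat_mult of_nat_numeral of_nat_power)
  then have "1 / 4 = of_nat N + P ^ 2 * - (3 / 4)" by (simp add: field_simps)
  moreover have "- (3 / 4) \<in> Z" by (intro Z_minus Z_div_numeral Z_numeral)
  ultimately have "cg 2 (1 / 4) (of_nat N)" by (rule cgI)
  then have "cg 2 (of_int (?x 2)) (of_int (int N))"
    using cg_trans[OF padic_of_rat_cong(2)[OF Z, of 2]] by simp
  then have "[int (nat (?x 2)) = int N] (mod int p ^ 2)"
    using x unfolding cg_int_iff padic_int_simps(1) by simp
  then have "[morita p (nat (?x 2)) = morita p N] (mod int p ^ 2)" by (rule morita_cong)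
  then have "[morita p (nat (?x 2)) mod int p ^ 2 = morita p N] (mod int p ^ 2)"
    by (simp only: cong_def mod_mod_trivial)
  then have "cg 2 (of_int (padic_Gamma p ?x 2)) (of_int (morita p N))"
    unfolding padic_Gamma_component(2)[OF x] cg_int_iff .
  then show ?thesis using padic_Gamma_component(1)[OF x] by (simp add: represents_def)
qed

section \<open>The four congruences between rationals\<close>

abbreviation binomial_sum :: "nat \<Rightarrow> rat" where
  "binomial_sum r \<equiv> (\<Sum>k=1..p-1. of_nat ((2 * k) choose k) ^ 3 * (gen_harm r k / 64 ^ k))"

lemma coprime_const:
  assumes "h < p"
  shows "coprime (2 ^ (p - 1) * fact h ^ 4 :: nat) p" "coprime (4 * fact h ^ 2 :: nat) p"
proof -
  have "\<not> p dvd fact h" using assms prime_dvd_fact_iff[OF prime_p] by simp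
  then have "coprime (fact h :: nat) p" using prime_p by (simp add: prime_imp_coprime coprime_commute)
  then show "coprime (2 ^ (p - 1) * fact h ^ 4 :: nat) p" "coprime (4 * fact h ^ 2 :: nat) p"
    using coprime_23 by simp_all
qed

lemma binomial_sum_1_mod_4:
  assumes "even n" "4 * N = 3 * p\<^sup>2 + 1"
  shows "cg 2 (binomial_sum 1) (of_int (morita p N) ^ 4 * (2 * q - P * q\<^sup>2))"
    and "cg 2 (binomial_sum 2) (- (of_int (morita p N) ^ 4) * (4 * euler_number (p - 3) - 2 * euler_number (2 * p - 4)))"
proof -
  obtain m where m: "n = 2 * m" using assms(1) by blast
  let ?G = "of_int (morita p N) ^ 4 :: rat"
  let ?A = "\<Sum>j=1..n. (- 1) ^ j / of_nat j ^ 2 :: rat"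
  let ?E = "4 * euler_number (p - 3) - 2 * euler_number (2 * p - 4)"
  define c :: rat where "c = (\<Prod>j=1..m. (2 * of_nat j - 1) / (2 * of_nat j))\<^sup>2"
  \<comment> \<open>Thus the 16^m in the closed form of \<open>c\<close> is exactly the 2^(p-1) of
    \<open>gamma_1_mod_4\<close>.\<close>
  have "p - 1 = 4 * m" using p_n m by simp
  then have "(16 :: rat) ^ m = 2 ^ (p - 1)" by (simp add: power_mult)
  then have c: "2 ^ (p - 1) * fact m ^ 4 * c = fact n ^ 2"
    unfolding c_def legendre_sum_even_const by (simp add: m)
  have "m < p" using m p_n by simp
  have "cg 2 (2 ^ (p - 1) * fact m ^ 4 * - ?G) (2 ^ (p - 1) * fact m ^ 4 * c)"
    unfolding c using gamma_1_mod_4[OF assms] by (simp add: m mult_ac)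
  then have "cg 2 (of_nat (2 ^ (p - 1) * fact m ^ 4) * - ?G) (of_nat (2 ^ (p - 1) * fact m ^ 4) * c)"
    by simp
  then have G: "cg 2 c (- ?G)"
    by (rule cg_sym[OF cg_cancel_nat[OF _ coprime_const(1)[OF \<open>m < p\<close>]]])
  then have cZ: "c \<in> Z" by (rule cg_Z) simp
  have "cg 2 (binomial_sum 1) (c * H)"
    using binomial_sum_cong[of 1] legendre_sum_even(3)[of m] by (simp add: c_def m)
  also have "cg 2 \<dots> (- ?G * (- 2 * q + P * q\<^sup>2))" by (intro cg_mult G H_cong_2 cZ) simp
  finally show "cg 2 (binomial_sum 1) (?G * (2 * q - P * q\<^sup>2))" by (simp add: algebra_simps)
  have "cg 2 (binomial_sum 2) (c * ?A)"
    using binomial_sum_cong[of 2] legendre_sum_even(4)[of m] by (simp add: c_def m)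
  also have "cg 2 \<dots> (- ?G * ?E)" using alternating_harm_2_cong[OF assms(1)] cZ by (intro cg_mult G) simp_all
  finally show "cg 2 (binomial_sum 2) (- ?G * ?E)" .
qed

lemma binomial_sum_3_mod_4:
  assumes "odd n" "4 * N = 3 * p\<^sup>2 + 1"
  shows "cg 2 (binomial_sum 1) (- P / 12 * of_int (morita p N) ^ 4)"
    and "cg 2 (binomial_sum 2) (- 1 / 4 * of_int (morita p N) ^ 4)"
proof -
  obtain m where m: "n = Suc (2 * m)" using assms(1) by (auto elim: oddE)
  let ?G = "of_int (morita p N) ^ 4 :: rat"
  let ?V = "legendre_sum n (gen_harm 2)"
  \<comment> \<open>Here 2^(p-1) = 4 * 16^m has a factor 4 more than the closed form; this is the
    origin of the constant 1/4.\<close>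
  have "p - 1 = 4 * m + 2" using p_n m by simp
  then have "(2 :: rat) ^ (p - 1) = 4 * 16 ^ m" by (simp add: power_add power_mult)
  moreover have "?V = - (16 ^ m * fact m ^ 4 / (fact n)\<^sup>2)"
    unfolding m legendre_sum_odd(1) legendre_sum_odd_const ..
  ultimately have V: "4 * fact n ^ 2 * ?V = - (2 ^ (p - 1) * fact m ^ 4)" by simp
  have "n div 2 = m" using m by simp
  then have "cg 2 (4 * fact n ^ 2 * (- 1 / 4 * ?G)) (4 * fact n ^ 2 * ?V)"
    unfolding V using cg_minus[OF gamma_3_mod_4[OF assms]] by (simp add: mult_ac)
  then have "cg 2 (of_nat (4 * fact n ^ 2) * (- 1 / 4 * ?G)) (of_nat (4 * fact n ^ 2) * ?V)" by simp
  then have G: "cg 2 ?V (- 1 / 4 * ?G)"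
    by (rule cg_sym[OF cg_cancel_nat[OF _ coprime_const(2)[OF div2_less(2)]]])
  show "cg 2 (binomial_sum 2) (- 1 / 4 * ?G)" by (rule cg_trans[OF binomial_sum_cong G])
  have "cg 2 (binomial_sum 1) (P / 3 * ?V)" by (rule cg_trans[OF binomial_sum_cong harm_sum_odd[OF assms(1)]])
  also have "cg 2 \<dots> (P / 3 * (- 1 / 4 * ?G))" by (intro cg_mult_left G Z_div_numeral Z_of_nat)
  finally show "cg 2 (binomial_sum 1) (- P / 12 * ?G)" by simp
qed

lemma binomial_sum_Z: "binomial_sum r \<in> Z"
proof (rule cg_Z[OF binomial_sum_cong])
  show "legendre_sum n (gen_harm r) \<in> Z"
    unfolding legendre_sum_def using p_n by (intro Z_sum Z_mult legendre_coeff_Z Z_gen_harm) auto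
qed

end

theorem theorem2:
  fixes p :: nat
  assumes "prime p" and "p > 3"
  shows
    "(p mod 4 = 1 \<longrightarrow>
        padic_cong p 2
          (padic_of_rat p (\<Sum>k=1..p-1. of_nat ((2 * k) choose k) ^ 3 * (gen_harm 1 k / 64 ^ k)))
          (padic_Gamma p (padic_of_rat p (1 / 4)) [^]\<^bsub>padic_int p\<^esub> (4::nat) \<otimes>\<^bsub>padic_int p\<^esub>
           padic_of_rat p (2 * fermat_quotient p 2 - of_nat p * fermat_quotient p 2 ^ 2))) \<and>
     (p mod 4 = 3 \<longrightarrow>
        padic_cong p 2
          (padic_of_rat p (\<Sum>k=1..p-1. of_nat ((2 * k) choose k) ^ 3 * (gen_harm 1 k / 64 ^ k)))
          (padic_of_rat p (- of_nat p / 12) \<otimes>\<^bsub>padic_int p\<^esub>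
           padic_Gamma p (padic_of_rat p (1 / 4)) [^]\<^bsub>padic_int p\<^esub> (4::nat))) \<and>
     (p mod 4 = 1 \<longrightarrow>
        padic_cong p 2
          (padic_of_rat p (\<Sum>k=1..p-1. of_nat ((2 * k) choose k) ^ 3 * (gen_harm 2 k / 64 ^ k)))
          (\<ominus>\<^bsub>padic_int p\<^esub> (padic_Gamma p (padic_of_rat p (1 / 4)) [^]\<^bsub>padic_int p\<^esub> (4::nat)) \<otimes>\<^bsub>padic_int p\<^esub>
           padic_of_rat p (4 * euler_number (p - 3) - 2 * euler_number (2 * p - 4)))) \<and>
     (p mod 4 = 3 \<longrightarrow>
        padic_cong p 2
          (padic_of_rat p (\<Sum>k=1..p-1. of_nat ((2 * k) choose k) ^ 3 * (gen_harm 2 k / 64 ^ k)))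
          (padic_of_rat p (- 1 / 4) \<otimes>\<^bsub>padic_int p\<^esub>
           padic_Gamma p (padic_of_rat p (1 / 4)) [^]\<^bsub>padic_int p\<^esub> (4::nat)))"
proof -
  define n where "n = p div 2"
  have "odd p" using assms prime_odd_nat by simp
  then have pn: "p = 2 * n + 1" unfolding n_def by presburger
  interpret prime_gt_3 p n by unfold_locales (use assms pn in simp_all)
  \<comment> \<open>This is (3p^2 + 1) / 4 with p = 2n + 1, written without division.\<close>
  define N where "N = 3 * n\<^sup>2 + 3 * n + 1"
  have N: "4 * N = 3 * p\<^sup>2 + 1"
    unfolding N_def pn by (simp add: power2_eq_square algebra_simps)
  let ?G = "padic_Gamma p (padic_of_rat p (1 / 4)) [^]\<^bsub>padic_int p\<^esub> (4::nat)"
  note G = represents_power[OF represents_Gamma_quarter[OF N], of 4]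
  note S = represents_of_rat[OF binomial_sum_Z]
  have Z: "2 * q - of_nat p * q\<^sup>2 \<in> p_integral p"
    "4 * euler_number (p - 3) - 2 * euler_number (2 * p - 4) \<in> p_integral p"
    "- 1 / 4 \<in> p_integral p"
    by (auto intro!: Z_div_numeral Z_minus Z_numeral)
  have "- of_nat p / 12 = - (of_nat p / 3 / 4 :: rat)" by simp
  also have "\<dots> \<in> p_integral p" by (intro Z_minus Z_div_numeral Z_of_nat)
  finally have Z12: "- of_nat p / 12 \<in> p_integral p" .
  show ?thesis
  proof (intro conjI impI)
    assume "p mod 4 = 1"
    then have n: "even n" using pn by presburger
    show "padic_cong p 2 (padic_of_rat p (binomial_sum 1))
        (?G \<otimes>\<^bsub>padic_int p\<^esub> padic_of_rat p (2 * q - of_nat p * q\<^sup>2))"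
      by (rule padic_cong_represents[OF S represents_mult[OF G represents_of_rat[OF Z(1)]]
          binomial_sum_1_mod_4(1)[OF n N]])
    show "padic_cong p 2 (padic_of_rat p (binomial_sum 2)) (\<ominus>\<^bsub>padic_int p\<^esub> ?G \<otimes>\<^bsub>padic_int p\<^esub>
        padic_of_rat p (4 * euler_number (p - 3) - 2 * euler_number (2 * p - 4)))"
      by (rule padic_cong_represents[OF S represents_mult[OF represents_uminus[OF G] represents_of_rat[OF Z(2)]]
          binomial_sum_1_mod_4(2)[OF n N]])
  next
    assume "p mod 4 = 3"
    then have n: "odd n" using pn by presburger
    show "padic_cong p 2 (padic_of_rat p (binomial_sum 1)) (padic_of_rat p (- of_nat p / 12) \<otimes>\<^bsub>padic_int p\<^esub> ?G)"
      by (rule padic_cong_represents[OF S represents_mult[OF represents_of_rat[OF Z12] G]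
          binomial_sum_3_mod_4(1)[OF n N]])
    show "padic_cong p 2 (padic_of_rat p (binomial_sum 2)) (padic_of_rat p (- 1 / 4) \<otimes>\<^bsub>padic_int p\<^esub> ?G)"
      by (rule padic_cong_represents[OF S represents_mult[OF represents_of_rat[OF Z(3)] G]
          binomial_sum_3_mod_4(2)[OF n N]])
  qed
qed

end
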